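(* Let $(\mathbf u^a,\theta^a,\mathbf u^o,\theta^o)$ be a sufficiently smooth solution of the deterministic atmosphere-ocean model, so that in particular $\mathrm{div}\,\mathbf u^o=0$ and $$\frac{\partial \mathbf u^o}{\partial t}+(\mathbf u^o\cdot\nabla)\mathbf u^o+\frac1{Ro^o}\mathbf u^{o\perp}+\frac1{Ro^o}\nabla(p^o+q^a)=\sigma(\mathbf u^o-\bar{\mathbf u}^a_{sol})+\frac1{Re^o}\Delta\mathbf u^o .$$ Then for every closed material loop $c(u^o)$ moving with the flow of the oceanic velocity $\mathbf u^o$, $$\frac{d}{dt}\oint_{c(u^o)}\Big(\mathbf u^o+\frac1{Ro^o}\mathbf R(\mathbf x)\Big)\cdot d\mathbf x=\oint_{c(u^o)}\Big(\sigma(\mathbf u^o-\bar{\mathbf u}^a)+\frac1{Re^o}\Delta\mathbf u^o\Big)\cdot d\mathbf x .$$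
   Context: The setting is a two-dimensional square $\Omega=[0,L]^2$ with periodic boundary conditions. $\mathbf u^a,\mathbf u^o$ are the atmospheric and oceanic velocities, $\theta^a,\theta^o$ the temperatures, $p^o$ the (scalar, periodic) ocean pressure. $Ro^o,Re^o>0$ and $\sigma<0$ are constants. The Leray-Helmholtz decomposition of the atmospheric velocity is $\mathbf u^a=\mathbf u^a_{sol}+\nabla q^a$ with $\mathrm{div}\,\mathbf u^a_{sol}=0$ and $q^a$ a periodic scalar function. For a field $\mathbf u$, $\bar{\mathbf u}:=\mathbf u-\frac1{|\Omega|}\int_\Omega\mathbf u\,dx$. $\mathbf R(\mathbf x)$ is a given smooth time-independent planar vector field on the domain with $\mathrm{curl}\,\mathbf R=2\Omega(\mathbf x)\hat{\mathbf z}$ (here $\Omega(\mathbf x)$ denotes the scalar rotation rate), where $\hat{\mathbf z}$ is the unit vector normal to the plane; the Coriolis term is $\mathbf u^{\perp}:=-\mathbf u\times\mathrm{curl}\,\mathbf R=2\Omega(\mathbf x)\,\hat{\mathbf z}\times\mathbf u$. A closed material loop $c(u^o)$ is the image of a fixed smooth closed loop under the flow of the time-dependent vector field $\mathbf u^o$. *)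

theory Defs
  imports "HOL-Analysis.Analysis"
begin

text \<open>The torus of side \<open>L\<close> is handled through its universal cover: fields on it are periodic
  functions on the whole plane \<open>real^2\<close>.\<close>

definition periodic :: "real \<Rightarrow> (real^2 \<Rightarrow> 'b) \<Rightarrow> bool" where
  "periodic L f \<longleftrightarrow> (\<forall>x i. f (x + L *\<^sub>R axis i 1) = f x)"

definition square :: "real \<Rightarrow> (real^2) set" where
  "square L = cbox 0 (\<chi> i. L)"

definition fluctuation :: "real \<Rightarrow> (real^2 \<Rightarrow> real^2) \<Rightarrow> real^2 \<Rightarrow> real^2" where
  "fluctuation L f x = f x - (1 / measure lborel (square L)) *\<^sub>R integral (square L) f"

definition partial_d :: "2 \<Rightarrow> (real^2 \<Rightarrow> 'b::real_normed_vector) \<Rightarrow> real^2 \<Rightarrow> 'b" where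
  "partial_d i f x = vector_derivative (\<lambda>h. f (x + h *\<^sub>R axis i 1)) (at 0)"

definition grad :: "(real^2 \<Rightarrow> real) \<Rightarrow> real^2 \<Rightarrow> real^2" where
  "grad f x = (\<chi> i. partial_d i f x)"

definition divergence :: "(real^2 \<Rightarrow> real^2) \<Rightarrow> real^2 \<Rightarrow> real" where
  "divergence f x = (\<Sum>i\<in>UNIV. partial_d i f x $ i)"

text \<open>The component of the curl along the unit normal of the plane.\<close>

definition curl :: "(real^2 \<Rightarrow> real^2) \<Rightarrow> real^2 \<Rightarrow> real" where
  "curl f x = partial_d 1 f x $ 2 - partial_d 2 f x $ 1"

definition laplacian :: "(real^2 \<Rightarrow> real^2) \<Rightarrow> real^2 \<Rightarrow> real^2" where
  "laplacian f x = (\<Sum>i\<in>UNIV. partial_d i (partial_d i f) x)"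

text \<open>\<open>advect u f\<close> is the field \<open>(u \<cdot> \<nabla>) f\<close>.\<close>

definition advect :: "(real^2 \<Rightarrow> real^2) \<Rightarrow> (real^2 \<Rightarrow> real^2) \<Rightarrow> real^2 \<Rightarrow> real^2" where
  "advect u f x = (\<Sum>i\<in>UNIV. (u x $ i) *\<^sub>R partial_d i f x)"

text \<open>With rotation rate \<open>\<omega>\<close>, the Coriolis term is \<open>2 \<omega> z \<times> u\<close>, where the cross product with
  the unit normal \<open>z\<close> is the rotation \<open>(u\<^sub>1, u\<^sub>2) \<mapsto> (-u\<^sub>2, u\<^sub>1)\<close>.\<close>

definition coriolis :: "(real^2 \<Rightarrow> real) \<Rightarrow> (real^2 \<Rightarrow> real^2) \<Rightarrow> real^2 \<Rightarrow> real^2" where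
  "coriolis \<omega> u x = (2 * \<omega> x) *\<^sub>R vector [- (u x $ 2), u x $ 1]"

text \<open>Time derivatives on \<open>[0,T]\<close> are one-sided at the two end points.\<close>

definition time_d :: "real \<Rightarrow> (real \<Rightarrow> real^2 \<Rightarrow> real^2) \<Rightarrow> real \<Rightarrow> real^2 \<Rightarrow> real^2" where
  "time_d T u t x = vector_derivative (\<lambda>\<tau>. u \<tau> x) (at t within {0..T})"

primrec Ck :: "nat \<Rightarrow> (real^2 \<Rightarrow> 'b::real_normed_vector) \<Rightarrow> bool" where
  "Ck 0 f \<longleftrightarrow> continuous_on UNIV f"
| "Ck (Suc k) f \<longleftrightarrow> f differentiable_on UNIV \<and> (\<forall>i. Ck k (partial_d i f))"

text \<open>Once continuously differentiable in time and twice in space, with all these derivatives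
  jointly continuous on \<open>[0,T] \<times> \<real>\<^sup>2\<close>.\<close>

definition C12 :: "real \<Rightarrow> (real \<Rightarrow> real^2 \<Rightarrow> real^2) \<Rightarrow> bool" where
  "C12 T u \<longleftrightarrow>
     (\<forall>t\<in>{0..T}. \<forall>x. (\<lambda>\<tau>. u \<tau> x) differentiable (at t within {0..T})) \<and>
     (\<forall>t\<in>{0..T}. Ck 2 (u t)) \<and>
     continuous_on ({0..T} \<times> UNIV) (\<lambda>(t, x). u t x) \<and>
     continuous_on ({0..T} \<times> UNIV) (\<lambda>(t, x). time_d T u t x) \<and>
     (\<forall>i. continuous_on ({0..T} \<times> UNIV) (\<lambda>(t, x). partial_d i (u t) x)) \<and>
     (\<forall>i j. continuous_on ({0..T} \<times> UNIV) (\<lambda>(t, x). partial_d i (partial_d j (u t)) x))"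

definition leray_helmholtz ::
    "real \<Rightarrow> (real^2 \<Rightarrow> real^2) \<Rightarrow> (real^2 \<Rightarrow> real^2) \<Rightarrow> (real^2 \<Rightarrow> real) \<Rightarrow> bool" where
  "leray_helmholtz L u usol q \<longleftrightarrow>
     periodic L usol \<and> periodic L q \<and> Ck 1 usol \<and> Ck 2 q \<and>
     (\<forall>x. u x = usol x + grad q x) \<and> (\<forall>x. divergence usol x = 0)"

text \<open>A closed loop on the torus is a curve in the plane whose end points differ by a period, so
  loops winding around the torus are included.\<close>

definition torus_loop :: "real \<Rightarrow> (real \<Rightarrow> real^2) \<Rightarrow> bool" where
  "torus_loop L c \<longleftrightarrow>
     c C1_differentiable_on {0..1} \<and> (\<forall>i. \<exists>k::int. (c 1 - c 0) $ i = of_int k * L)"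

definition is_flow ::
    "real \<Rightarrow> (real \<Rightarrow> real^2 \<Rightarrow> real^2) \<Rightarrow> (real \<Rightarrow> real^2 \<Rightarrow> real^2) \<Rightarrow> bool" where
  "is_flow T u \<phi> \<longleftrightarrow>
     (\<forall>x. \<phi> 0 x = x) \<and>
     (\<forall>x. \<forall>t\<in>{0..T}. ((\<lambda>\<tau>. \<phi> \<tau> x) has_vector_derivative u t (\<phi> t x)) (at t within {0..T}))"

definition line_integral :: "(real^2 \<Rightarrow> real^2) \<Rightarrow> (real \<Rightarrow> real^2) \<Rightarrow> real" where
  "line_integral F c =
     integral {0..1} (\<lambda>s. F (c s) \<bullet> vector_derivative c (at s within {0..1}))"

end

theory Submission
  imports Defs
begin

text \<open>The loop is carried by the flow of the oceanic velocity \<open>u\<close>. If \<open>w\<close> is its tangent, then \<open>w\<close>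
  satisfies the variational equation \<open>w' = Du w\<close>, and differentiating \<open>\<integral> (u + R / Ro) \<bullet> w ds\<close> under the
  integral sign gives the material derivative of \<open>u + R / Ro\<close> tested against \<open>w\<close>, plus
  \<open>(u + R / Ro) \<bullet> Du w\<close>. The momentum equation replaces the material derivative of \<open>u\<close>. The
  Coriolis force is the Jacobian of \<open>R\<close> minus its transpose, applied to \<open>u\<close> (\<open>curl_identity\<close>), so what
  remains of the terms in \<open>R\<close> adds up to the derivative of \<open>R \<bullet> u\<close> along the loop. The remaining unwanted
  terms are gradients: the pressure, the kinetic energy, and the potential part of the atmospheric
  velocity, which has mean zero and hence equals its own fluctuation (\<open>fluctuation_add_grad\<close>). The
  potential of all of them takes the same value at the two end points of the loop, which differ by a
  period at all times (\<open>endpoints_keep_period\<close>), so its derivative integrates to zero.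

  The analytic part is that the material loop remains continuously differentiable and that its
  tangent satisfies the variational equation. Neither is part of the notion of flow, which prescribes
  trajectories only, so both are derived from the smoothness of \<open>u\<close>. The means is a Gronwall
  inequality (\<open>gronwall_norm\<close>). The difference quotients of the curve solve the variational equation up
  to a small defect, hence are Cauchy uniformly in time; their limit solves it exactly
  (\<open>tangent_exists\<close>), is the derivative of the curve (\<open>tangent_is_derivative\<close>) and depends continuously
  on time and parameter (\<open>tangent_cont\<close>). The periodicity of \<open>u\<close> supplies the global bound on \<open>Du\<close>
  that these estimates need.\<close>

section \<open>Gronwall's inequality and limits uniform in a parameter\<close>

text \<open>Only the dependence on \<open>K\<close> and \<open>T\<close> matters below; the shape of the constant comes from running
  the Gronwall argument for the squared norm, whose growth rate is \<open>2 K + 1\<close>.\<close>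

definition gronwall_const :: "real \<Rightarrow> real \<Rightarrow> real" where
  "gronwall_const K T = sqrt ((1 + T) * exp ((2 * K + 1) * T))"

lemma gronwall_const_pos: "0 \<le> T \<Longrightarrow> 0 < gronwall_const K T"
  by (simp add: gronwall_const_def)

text \<open>The norm is not differentiable at \<open>0\<close>, but its square \<open>g = e \<bullet> e\<close> is, and
  \<open>g' \<le> 2 K g + 2 \<eta> \<parallel>e\<parallel> \<le> (2 K + 1) g + \<eta>\<^sup>2\<close>; the exponential weight then makes
  \<open>exp (- (2 K + 1) \<tau>) g \<tau> - \<eta>\<^sup>2 \<tau>\<close> nonincreasing. The conclusion is linear in the initial error and
  the defect \<open>\<eta>\<close>, so every stability estimate for the flow is one application of this lemma.\<close>

lemma gronwall_norm:
  fixes e :: "real \<Rightarrow> 'a::real_inner"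
  assumes deriv: "\<And>\<tau>. \<tau> \<in> {0..T} \<Longrightarrow> (e has_vector_derivative e' \<tau>) (at \<tau> within {0..T})"
    and bound: "\<And>\<tau>. \<tau> \<in> {0..T} \<Longrightarrow> norm (e' \<tau>) \<le> K * norm (e \<tau>) + \<eta>"
    and "0 \<le> K" "0 \<le> \<eta>" and t: "t \<in> {0..T}"
  shows "norm (e t) \<le> gronwall_const K T * (norm (e 0) + \<eta>)"
proof -
  define M where "M = 2 * K + 1"
  define g where "g \<tau> = exp (- M * \<tau>) * (e \<tau> \<bullet> e \<tau>) - \<eta>\<^sup>2 * \<tau>" for \<tau>
  define g' where "g' \<tau> = exp (- M * \<tau>) * (2 * (e \<tau> \<bullet> e' \<tau>)) - M * exp (- M * \<tau>) * (e \<tau> \<bullet> e \<tau>) - \<eta>\<^sup>2"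
    for \<tau>
  have T: "0 \<le> T" using t by auto
  have g: "(g has_real_derivative g' \<tau>) (at \<tau> within {0..T})" if "\<tau> \<in> {0..T}" for \<tau>
  proof -
    have "((\<lambda>\<tau>. e \<tau> \<bullet> e \<tau>) has_derivative (\<lambda>h. e \<tau> \<bullet> (h *\<^sub>R e' \<tau>) + (h *\<^sub>R e' \<tau>) \<bullet> e \<tau>)) (at \<tau> within {0..T})"
      using deriv[OF that] unfolding has_vector_derivative_def by (intro has_derivative_inner)
    then have "((\<lambda>\<tau>. e \<tau> \<bullet> e \<tau>) has_real_derivative 2 * (e \<tau> \<bullet> e' \<tau>)) (at \<tau> within {0..T})"
      unfolding has_field_derivative_def
      by (rule has_derivative_eq_rhs) (auto simp: inner_commute)
    then show ?thesis
      unfolding g_def g'_def by (auto intro!: derivative_eq_intros)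
  qed
  have g'_nonpos: "g' \<tau> \<le> 0" if \<tau>: "\<tau> \<in> {0..T}" for \<tau>
  proof -
    have "2 * (e \<tau> \<bullet> e' \<tau>) \<le> 2 * (norm (e \<tau>) * (K * norm (e \<tau>) + \<eta>))"
      using norm_cauchy_schwarz[of "e \<tau>" "e' \<tau>"] mult_left_mono[OF bound[OF \<tau>] norm_ge_zero[of "e \<tau>"]]
      by linarith
    also have "\<dots> \<le> M * (norm (e \<tau>))\<^sup>2 + \<eta>\<^sup>2"
      using zero_le_power2[of "norm (e \<tau>) - \<eta>"] by (simp add: M_def power2_eq_square algebra_simps)
    finally have le: "2 * (e \<tau> \<bullet> e' \<tau>) - M * (e \<tau> \<bullet> e \<tau>) \<le> \<eta>\<^sup>2"
      by (simp add: power2_norm_eq_inner)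
    have "exp (- M * \<tau>) \<le> 1"
      using \<tau> \<open>0 \<le> K\<close> by (simp add: M_def mult_nonpos_nonneg)
    then have "exp (- M * \<tau>) * (2 * (e \<tau> \<bullet> e' \<tau>) - M * (e \<tau> \<bullet> e \<tau>)) \<le> 1 * \<eta>\<^sup>2"
      by (intro order_trans[OF mult_left_mono[OF le] mult_right_mono]) auto
    then show ?thesis by (simp add: g'_def algebra_simps)
  qed
  have "g t \<le> g 0"
  proof -
    have "\<exists>x\<in>{0..t}. g t - g 0 = g' x * (t - 0)"
    proof (rule mvt_very_simple)
      fix x assume "0 \<le> x" "x \<le> t"
      then have "(g has_derivative (*) (g' x)) (at x within {0..T})"
        using g[of x] t by (simp add: has_field_derivative_def)
      then show "(g has_derivative (*) (g' x)) (at x within {0..t})"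
        by (rule has_derivative_subset) (use t in auto)
    qed (use t in auto)
    then obtain x where x: "x \<in> {0..t}" "g t - g 0 = g' x * (t - 0)" by blast
    have "g' x * (t - 0) \<le> 0"
      using g'_nonpos[of x] x(1) t by (intro mult_nonpos_nonneg) auto
    then show ?thesis using x(2) by linarith
  qed
  then have *: "exp (- M * t) * (norm (e t))\<^sup>2 \<le> (norm (e 0))\<^sup>2 + \<eta>\<^sup>2 * t"
    by (simp add: g_def power2_norm_eq_inner)
  have "(norm (e t))\<^sup>2 = exp (M * t) * (exp (- M * t) * (norm (e t))\<^sup>2)"
    by (simp add: mult.assoc[symmetric] flip: exp_add)
  also have "\<dots> \<le> exp (M * T) * ((norm (e 0))\<^sup>2 + \<eta>\<^sup>2 * T)"
  proof (intro mult_mono)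
    show "exp (M * t) \<le> exp (M * T)" using t \<open>0 \<le> K\<close> by (auto simp: M_def intro!: mult_left_mono)
    show "exp (- M * t) * (norm (e t))\<^sup>2 \<le> (norm (e 0))\<^sup>2 + \<eta>\<^sup>2 * T"
      using * mult_left_mono[of t T "\<eta>\<^sup>2"] t by auto
  qed auto
  also have "\<dots> \<le> exp (M * T) * ((1 + T) * (norm (e 0) + \<eta>)\<^sup>2)"
  proof (intro mult_left_mono)
    have "(norm (e 0))\<^sup>2 + \<eta>\<^sup>2 \<le> (norm (e 0) + \<eta>)\<^sup>2"
      using \<open>0 \<le> \<eta>\<close> by (simp add: power2_sum)
    moreover have "(norm (e 0))\<^sup>2 + \<eta>\<^sup>2 * T \<le> (1 + T) * ((norm (e 0))\<^sup>2 + \<eta>\<^sup>2)"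
      using T by (simp add: algebra_simps)
    ultimately show "(norm (e 0))\<^sup>2 + \<eta>\<^sup>2 * T \<le> (1 + T) * (norm (e 0) + \<eta>)\<^sup>2"
      using T by (meson add_nonneg_nonneg mult_left_mono order_trans zero_le_one)
  qed auto
  also have "\<dots> = (gronwall_const K T * (norm (e 0) + \<eta>))\<^sup>2"
    using T by (simp add: gronwall_const_def M_def power_mult_distrib)
  finally show ?thesis
    using gronwall_const_pos[OF T, of K] \<open>0 \<le> \<eta>\<close> by (simp add: power2_le_iff_abs_le)
qed

text \<open>Joint continuity of the trajectories and of the tangent field is obtained through the next lemma:
  Gronwall estimates are uniform in time, so they yield uniform limits in the curve parameter. The
  lemma after it is the converse on compact sets and feeds the coefficients back into such estimates.\<close>

lemma continuous_on_Times_if_uniform_limit: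
  fixes f :: "'a::metric_space \<Rightarrow> 'b::metric_space \<Rightarrow> 'c::metric_space"
  assumes cont: "\<And>s. s \<in> S \<Longrightarrow> continuous_on X (\<lambda>t. f t s)"
    and lim: "\<And>s. s \<in> S \<Longrightarrow> uniform_limit X (\<lambda>r t. f t r) (\<lambda>t. f t s) (at s within S)"
  shows "continuous_on (X \<times> S) (\<lambda>(t, s). f t s)"
  unfolding continuous_on_iff
proof (intro ballI allI impI)
  fix x and e :: real assume x: "x \<in> X \<times> S" and e: "0 < e"
  obtain t s where [simp]: "x = (t, s)" and ts: "t \<in> X" "s \<in> S" using x by blast
  obtain d where d: "0 < d" "\<And>r \<tau>. r \<in> S \<Longrightarrow> dist r s < d \<Longrightarrow> \<tau> \<in> X \<Longrightarrow> dist (f \<tau> r) (f \<tau> s) < e / 2"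
    using uniform_limitD[OF lim[OF ts(2)], of "e / 2"] e unfolding eventually_at
    by (metis dist_self half_gt_zero zero_less_dist_iff)
  obtain d' where d': "0 < d'" "\<And>\<tau>. \<tau> \<in> X \<Longrightarrow> dist \<tau> t < d' \<Longrightarrow> dist (f \<tau> s) (f t s) < e / 2"
    using cont[OF ts(2)] ts(1) e unfolding continuous_on_iff by (meson half_gt_zero)
  show "\<exists>d>0. \<forall>x'\<in>X \<times> S. dist x' x < d \<longrightarrow>
      dist (case x' of (t, s) \<Rightarrow> f t s) (case x of (t, s) \<Rightarrow> f t s) < e"
  proof (intro exI[of _ "min d d'"] conjI ballI impI)
    fix x' assume x': "x' \<in> X \<times> S" "dist x' x < min d d'"
    obtain \<tau> r where [simp]: "x' = (\<tau>, r)" by (cases x')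
    have "dist \<tau> t < d'" "dist r s < d"
      using x' dist_fst_le[of x' "(t, s)"] dist_snd_le[of x' "(t, s)"] by auto
    then show "dist (case x' of (t, s) \<Rightarrow> f t s) (case x of (t, s) \<Rightarrow> f t s) < e"
      using d(2)[of r \<tau>] d'(2)[of \<tau>] x' dist_triangle[of "f \<tau> r" "f t s" "f \<tau> s"] by simp
  qed (use d(1) d'(1) in simp)
qed

lemma uniform_limit_if_continuous_on_Times:
  fixes f :: "'a::metric_space \<Rightarrow> 'b::metric_space \<Rightarrow> 'c::metric_space"
  assumes "compact X" "compact S" and cont: "continuous_on (X \<times> S) (\<lambda>(t, s). f t s)" and "s \<in> S"
  shows "uniform_limit X (\<lambda>r t. f t r) (\<lambda>t. f t s) (at s within S)"
proof (rule uniform_limitI)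
  fix e :: real assume "0 < e"
  have "uniformly_continuous_on (X \<times> S) (\<lambda>(t, s). f t s)"
    using assms by (intro compact_uniformly_continuous compact_Times)
  then obtain d where d: "0 < d" "\<And>x x'. x \<in> X \<times> S \<Longrightarrow> x' \<in> X \<times> S \<Longrightarrow> dist x' x < d \<Longrightarrow>
      dist (case x' of (t, s) \<Rightarrow> f t s) (case x of (t, s) \<Rightarrow> f t s) < e"
    unfolding uniformly_continuous_on_def using \<open>0 < e\<close> by meson
  show "\<forall>\<^sub>F r in at s within S. \<forall>t\<in>X. dist (f t r) (f t s) < e"
    unfolding eventually_at
    using d(1) d(2)[of "(t, s)" "(t, r)" for t r] \<open>s \<in> S\<close> by (auto simp: dist_Pair_Pair intro!: exI[of _ d])
qed

text \<open>This form of the derivative is the one that Gronwall estimates reach, because difference quotients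
  of trajectories obey a differential equation in time.\<close>

lemma has_vector_derivative_iff_quotient:
  "(f has_vector_derivative f') (at s within S) \<longleftrightarrow>
    ((\<lambda>r. (f r - f s) /\<^sub>R (r - s)) \<longlongrightarrow> f') (at s within S)"
proof -
  have "(f has_vector_derivative f') (at s within S) \<longleftrightarrow>
      ((\<lambda>r. norm ((f r - f s - (r - s) *\<^sub>R f') /\<^sub>R norm (r - s))) \<longlongrightarrow> 0) (at s within S)"
    unfolding tendsto_norm_zero_iff
    by (simp add: has_vector_derivative_def has_derivative_within bounded_linear_scaleR_left
        inverse_eq_divide diff_diff_eq)
  also have "\<dots> \<longleftrightarrow> ((\<lambda>r. norm ((f r - f s) /\<^sub>R (r - s) - f')) \<longlongrightarrow> 0) (at s within S)"
  proof (rule tendsto_cong, unfold eventually_at_filter, intro always_eventually allI impI)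
    fix r assume "r \<noteq> s"
    then have "f' = ((r - s) *\<^sub>R f') /\<^sub>R (r - s)" by simp
    then have "(f r - f s) /\<^sub>R (r - s) - f' = (f r - f s - (r - s) *\<^sub>R f') /\<^sub>R (r - s)"
      unfolding scaleR_diff_right by metis
    then show "norm ((f r - f s - (r - s) *\<^sub>R f') /\<^sub>R norm (r - s)) = norm ((f r - f s) /\<^sub>R (r - s) - f')"
      by simp
  qed
  also have "\<dots> \<longleftrightarrow> ((\<lambda>r. (f r - f s) /\<^sub>R (r - s)) \<longlongrightarrow> f') (at s within S)"
    by (simp add: tendsto_norm_zero_iff LIM_zero_iff)
  finally show ?thesis .
qed

section \<open>Curves carried by a flow\<close>

text \<open>A curve \<open>y 0\<close> is carried by the flow of the time-dependent field \<open>v\<close>, whose spatial derivative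
  \<open>A\<close> is bounded. Only the trajectories through the curve enter, not a flow map, so nothing is assumed
  about the dependence of \<open>y t s\<close> on \<open>s\<close> at positive times: that \<open>y t\<close> is again a \<open>C\<^sup>1\<close> curve is
  what has to be proved.\<close>

locale curve_in_flow =
  fixes T K :: real
    and v :: "real \<Rightarrow> 'a::euclidean_space \<Rightarrow> 'a"
    and A :: "real \<Rightarrow> 'a \<Rightarrow> 'a \<Rightarrow>\<^sub>L 'a"
    and y :: "real \<Rightarrow> real \<Rightarrow> 'a"
    and c' :: "real \<Rightarrow> 'a"
  assumes T: "0 \<le> T"
    and v_deriv: "\<And>t x. t \<in> {0..T} \<Longrightarrow> (v t has_derivative A t x) (at x)"
    and A_cont: "continuous_on ({0..T} \<times> UNIV) (\<lambda>(t, x). A t x)"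
    and A_bound: "\<And>t x. t \<in> {0..T} \<Longrightarrow> norm (A t x) \<le> K"
    and trajectory: "\<And>t s. t \<in> {0..T} \<Longrightarrow> s \<in> {0..1} \<Longrightarrow>
      ((\<lambda>\<tau>. y \<tau> s) has_vector_derivative v t (y t s)) (at t within {0..T})"
    and initial_tangent: "\<And>s. s \<in> {0..1} \<Longrightarrow>
      ((\<lambda>s. y 0 s) has_vector_derivative c' s) (at s within {0..1})"
    and v_cont: "continuous_on ({0..T} \<times> UNIV) (\<lambda>(t, x). v t x)"
    and c'_cont: "continuous_on {0..1} c'"
begin

abbreviation "C \<equiv> gronwall_const K T"

lemma C_pos: "0 < C"
  using T by (rule gronwall_const_pos)

lemma K_nonneg: "0 \<le> K"
  using order_trans[OF norm_ge_zero A_bound[of 0 0]] T by simp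

lemma lipschitz: "t \<in> {0..T} \<Longrightarrow> norm (v t x - v t x') \<le> K * norm (x - x')"
  by (rule differentiable_bound[of UNIV "v t" "\<lambda>x. blinfun_apply (A t x)"])
    (auto intro: v_deriv A_bound simp flip: norm_blinfun.rep_eq)

lemma separation:
  assumes "t \<in> {0..T}" "s \<in> {0..1}" "s' \<in> {0..1}"
  shows "norm (y t s - y t s') \<le> C * norm (y 0 s - y 0 s')"
  using gronwall_norm[where e = "\<lambda>\<tau>. y \<tau> s - y \<tau> s'" and e' = "\<lambda>\<tau>. v \<tau> (y \<tau> s) - v \<tau> (y \<tau> s')"
      and T = T and K = K and \<eta> = 0 and t = t] assms K_nonneg
  by (simp add: lipschitz trajectory has_vector_derivative_diff)

lemma y0_tendsto: "s \<in> {0..1} \<Longrightarrow> ((\<lambda>r. y 0 r) \<longlongrightarrow> y 0 s) (at s within {0..1})"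
  using has_vector_derivative_continuous[OF initial_tangent] by (simp add: continuous_within)

lemma y_uniform_limit:
  assumes s: "s \<in> {0..1}"
  shows "uniform_limit {0..T} (\<lambda>r t. y t r) (\<lambda>t. y t s) (at s within {0..1})"
proof (rule uniform_limitI)
  fix e :: real assume "0 < e"
  then have "\<forall>\<^sub>F r in at s within {0..1}. dist (y 0 r) (y 0 s) < e / C"
    using y0_tendsto[OF s] C_pos by (intro tendstoD) auto
  moreover have "\<forall>\<^sub>F r in at s within {0..1}. r \<in> {0..1}"
    by (simp add: eventually_at_filter)
  ultimately show "\<forall>\<^sub>F r in at s within {0..1}. \<forall>t\<in>{0..T}. dist (y t r) (y t s) < e"
  proof eventually_elim
    case (elim r)
    then have "C * norm (y 0 r - y 0 s) < e"
      using C_pos by (simp add: dist_norm field_simps)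
    then show ?case
      using separation[OF _ elim(2) s] by (force simp: dist_norm)
  qed
qed

lemma y_cont: "continuous_on ({0..T} \<times> {0..1}) (\<lambda>(t, s). y t s)"
proof (rule continuous_on_Times_if_uniform_limit)
  show "continuous_on {0..T} (\<lambda>t. y t s)" if "s \<in> {0..1}" for s
    using has_vector_derivative_continuous[OF trajectory[OF _ that]]
    by (auto simp: continuous_on_eq_continuous_within)
qed (rule y_uniform_limit)

lemma continuous_on_along:
  assumes "continuous_on ({0..T} \<times> UNIV) (\<lambda>(t, x). f t x)"
  shows "continuous_on ({0..T} \<times> {0..1}) (\<lambda>(t, s). f t (y t s))"
proof -
  have "continuous_on ({0..T} \<times> {0..1}) (\<lambda>z. (fst z, (\<lambda>(t, s). y t s) z))"
    by (intro continuous_intros y_cont)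
  then have "continuous_on ({0..T} \<times> {0..1}) (\<lambda>z. (\<lambda>(t, x). f t x) (fst z, (\<lambda>(t, s). y t s) z))"
    by (rule continuous_on_compose2[OF assms]) auto
  then show ?thesis
    by (simp add: split_beta)
qed

definition stretching :: "real \<Rightarrow> real \<Rightarrow> 'a \<Rightarrow>\<^sub>L 'a" where
  "stretching t s = A t (y t s)"

lemma stretching_cont: "continuous_on ({0..T} \<times> {0..1}) (\<lambda>(t, s). stretching t s)"
  unfolding stretching_def by (rule continuous_on_along[OF A_cont])

lemma stretching_bound: "t \<in> {0..T} \<Longrightarrow> norm (stretching t s x) \<le> K * norm x"
  unfolding stretching_def by (meson A_bound mult_right_mono norm_blinfun norm_ge_zero order_trans)

text \<open>On a compact neighbourhood of a trajectory \<open>A\<close> is uniformly continuous, which makes the error in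
  the first-order expansion of \<open>v t\<close> small relative to the separation, at all times at once.\<close>

lemma linearization:
  assumes s: "s \<in> {0..1}" and "0 < \<epsilon>"
  shows "\<forall>\<^sub>F r in at s within {0..1}. \<forall>t\<in>{0..T}.
    norm (v t (y t r) - v t (y t s) - stretching t s (y t r - y t s)) \<le> \<epsilon> * norm (y t r - y t s)"
proof -
  have "compact ((\<lambda>t. y t s) ` {0..T})"
    using has_vector_derivative_continuous[OF trajectory[OF _ s]]
    by (intro compact_continuous_image) (auto simp: continuous_on_eq_continuous_within)
  then obtain M where M: "\<And>t. t \<in> {0..T} \<Longrightarrow> norm (y t s) \<le> M"
    using compact_imp_bounded bounded_iff by (metis imageI)
  have "uniformly_continuous_on ({0..T} \<times> cball 0 (M + 1)) (\<lambda>(t, x). A t x)"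
    by (intro compact_uniformly_continuous compact_Times continuous_on_subset[OF A_cont]) auto
  then obtain d where d: "0 < d"
    "\<And>t x x'. t \<in> {0..T} \<Longrightarrow> x \<in> cball 0 (M + 1) \<Longrightarrow> x' \<in> cball 0 (M + 1) \<Longrightarrow> dist x' x < d \<Longrightarrow>
      dist (A t x') (A t x) < \<epsilon>"
    unfolding uniformly_continuous_on_def using \<open>0 < \<epsilon>\<close>
    by (force simp: dist_Pair_Pair)
  define \<delta> where "\<delta> = min d 1"
  have \<delta>: "0 < \<delta>" "\<delta> \<le> d" "\<delta> \<le> 1" using d(1) by (auto simp: \<delta>_def)
  show ?thesis
    using uniform_limitD[OF y_uniform_limit[OF s] \<delta>(1)]
  proof eventually_elim
    case (elim r)
    show ?case
    proof
      fix t assume t: "t \<in> {0..T}"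
      let ?S = "ball (y t s) \<delta>"
      have "norm (v t (y t r) - v t (y t s) - blinfun_apply (stretching t s) (y t r - y t s))
          \<le> norm (y t r - y t s) * \<epsilon>"
        unfolding stretching_def
      proof (rule differentiable_bound_linearization[where f' = "\<lambda>x. blinfun_apply (A t x)" and S = ?S])
        show "y t s + \<tau> *\<^sub>R (y t r - y t s) \<in> ?S" if "\<tau> \<in> {0..1}" for \<tau>
        proof -
          have "\<tau> * norm (y t r - y t s) \<le> 1 * norm (y t r - y t s)"
            using that by (intro mult_right_mono) auto
          moreover have "norm (y t r - y t s) < \<delta>"
            using elim t by (simp add: dist_norm)
          ultimately show ?thesis
            using that by (simp add: dist_norm)
        qed
        show "(v t has_derivative A t x) (at x within ?S)" for x
          by (rule has_derivative_at_withinI[OF v_deriv[OF t]])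
        show "onorm (blinfun_apply (A t x) - blinfun_apply (A t (y t s))) \<le> \<epsilon>" if x: "x \<in> ?S" for x
        proof -
          have "norm x \<le> norm (y t s) + dist (y t s) x"
            by (metis dist_0_norm dist_triangle)
          then have "dist (A t x) (A t (y t s)) < \<epsilon>"
            using x M[OF t] \<delta> by (intro d(2)[OF t]) (auto simp: dist_commute)
          then show ?thesis
            by (simp add: dist_norm norm_blinfun.rep_eq minus_blinfun.rep_eq fun_diff_def)
        qed
      qed (use \<delta> in auto)
      then show "norm (v t (y t r) - v t (y t s) - blinfun_apply (stretching t s) (y t r - y t s))
          \<le> \<epsilon> * norm (y t r - y t s)"
        by (simp add: mult.commute)
    qed
  qed
qed

definition quotient :: "real \<Rightarrow> real \<Rightarrow> real \<Rightarrow> 'a" where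
  "quotient s r t = (y t r - y t s) /\<^sub>R (r - s)"

definition quotient' :: "real \<Rightarrow> real \<Rightarrow> real \<Rightarrow> 'a" where
  "quotient' s r t = (v t (y t r) - v t (y t s)) /\<^sub>R (r - s)"

lemma quotient_deriv:
  assumes "t \<in> {0..T}" "s \<in> {0..1}" "r \<in> {0..1}"
  shows "(quotient s r has_vector_derivative quotient' s r t) (at t within {0..T})"
  unfolding quotient_def quotient'_def
  by (intro derivative_intros bounded_linear.has_vector_derivative[OF bounded_linear_scaleR_right]
      trajectory assms)

lemma quotient_initial:
  assumes "s \<in> {0..1}"
  shows "((\<lambda>r. quotient s r 0) \<longlongrightarrow> c' s) (at s within {0..1})"
  using initial_tangent[OF assms] unfolding has_vector_derivative_iff_quotient quotient_def .

text \<open>A difference quotient in \<open>s\<close> solves the variational equation up to an error that vanishes in the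
  limit: the linearization error is relative to the separation, and dividing by \<open>r - s\<close> leaves it
  relative to the quotient, which is bounded by the Lipschitz dependence on initial data.\<close>

lemma quotient_almost_solves:
  assumes s: "s \<in> {0..1}" and "0 < \<epsilon>"
  shows "\<forall>\<^sub>F r in at s within {0..1}. r \<in> {0..1} \<and> (\<forall>t\<in>{0..T}.
    norm (quotient' s r t - stretching t s (quotient s r t)) \<le> \<epsilon>)"
proof -
  define M where "M = C * (norm (c' s) + 1)"
  have M: "0 < M" unfolding M_def using C_pos by (intro mult_pos_pos) (auto simp: add_nonneg_pos)
  have "\<forall>\<^sub>F r in at s within {0..1}. dist (quotient s r 0) (c' s) < 1"
    by (intro tendstoD quotient_initial s) auto
  moreover have "\<forall>\<^sub>F r in at s within {0..1}. r \<in> {0..1} \<and> r \<noteq> s"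
    by (auto simp: eventually_at_filter)
  moreover have "0 < \<epsilon> / M" using \<open>0 < \<epsilon>\<close> M by simp
  note linearization[OF s this]
  ultimately show ?thesis
  proof eventually_elim
    case (elim r)
    then have r: "r \<in> {0..1}" "r \<noteq> s" by auto
    have "norm (quotient s r 0) \<le> norm (c' s) + 1"
      using elim(1) norm_triangle_ineq2[of "quotient s r 0" "c' s"] by (simp add: dist_norm)
    then have bound: "C * norm (quotient s r 0) \<le> M"
      unfolding M_def using C_pos by (intro mult_left_mono) auto
    show ?case
    proof (intro conjI ballI)
      fix t assume t: "t \<in> {0..T}"
      have "norm (quotient s r t) \<le> C * norm (quotient s r 0)"
        using mult_left_mono[OF separation[OF t r(1) s], of "inverse \<bar>r - s\<bar>"]
        by (simp add: quotient_def mult.left_commute)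
      with bound have q: "norm (quotient s r t) \<le> M" by linarith
      have "quotient' s r t - stretching t s (quotient s r t) =
          (v t (y t r) - v t (y t s) - stretching t s (y t r - y t s)) /\<^sub>R (r - s)"
        by (simp add: quotient_def quotient'_def blinfun.scaleR_right blinfun.diff_right scaleR_diff_right)
      then have "norm (quotient' s r t - stretching t s (quotient s r t)) =
          inverse \<bar>r - s\<bar> * norm (v t (y t r) - v t (y t s) - stretching t s (y t r - y t s))"
        by simp
      also have "\<dots> \<le> inverse \<bar>r - s\<bar> * (\<epsilon> / M * norm (y t r - y t s))"
        using elim(3) t \<open>0 < \<epsilon>\<close> M by (intro mult_left_mono) auto
      also have "\<dots> = \<epsilon> / M * norm (quotient s r t)"
        by (simp add: quotient_def)
      also have "\<dots> \<le> \<epsilon> / M * M"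
        using q \<open>0 < \<epsilon>\<close> M by (intro mult_left_mono) auto
      finally show "norm (quotient' s r t - stretching t s (quotient s r t)) \<le> \<epsilon>"
        using M by simp
    qed (rule r)
  qed
qed

text \<open>The variational equation \<open>w' = A w\<close> is solved without Picard iteration. Along a sequence tending
  to \<open>s\<close> the difference quotients solve it approximately with converging initial values, so by the
  Gronwall estimate they form a uniform Cauchy sequence; their derivatives then converge uniformly
  too, and the limit is an exact solution.\<close>

lemma tangent_exists:
  assumes s: "s \<in> {0..1}"
  shows "\<exists>w. w 0 = c' s \<and> (\<forall>t\<in>{0..T}. (w has_vector_derivative stretching t s (w t)) (at t within {0..T}))"
proof -
  have "s islimpt {0..1::real}" using s by (simp add: islimpt_Icc)
  then obtain r where r: "\<And>n. r n \<in> {0..1} - {s}" "r \<longlonglongrightarrow> s"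
    unfolding islimpt_sequential by blast
  then have lim: "filterlim r (at s within {0..1}) sequentially"
    by (auto simp: filterlim_at)
  define D where "D n = quotient s (r n)" for n
  define D' where "D' n = quotient' s (r n)" for n
  have D_deriv: "(D n has_vector_derivative D' n t) (at t within {0..T})" if "t \<in> {0..T}" for n t
    unfolding D_def D'_def using quotient_deriv[OF that s] r(1) by auto
  have D_init: "(\<lambda>n. D n 0) \<longlonglongrightarrow> c' s"
    unfolding D_def by (rule filterlim_compose[OF quotient_initial[OF s] lim])
  have almost: "\<forall>\<^sub>F n in sequentially. \<forall>t\<in>{0..T}. norm (D' n t - stretching t s (D n t)) \<le> \<epsilon>" if "0 < \<epsilon>" for \<epsilon>
    using eventually_compose_filterlim[OF quotient_almost_solves[OF s that] lim]
    unfolding D_def D'_def by eventually_elim simp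
  have "uniformly_Cauchy_on {0..T} D"
  proof (rule uniformly_Cauchy_onI)
    fix e :: real assume "0 < e"
    \<comment> \<open>The initial gap is below \<open>\<epsilon>\<close> and the two defects add up to \<open>2 \<epsilon>\<close>, so the gap stays below
      \<open>3 C \<epsilon>\<close>.\<close>
    define \<epsilon> where "\<epsilon> = e / (4 * C)"
    have "0 < \<epsilon>" using \<open>0 < e\<close> C_pos by (simp add: \<epsilon>_def)
    have "\<forall>\<^sub>F n in sequentially. (\<forall>t\<in>{0..T}. norm (D' n t - stretching t s (D n t)) \<le> \<epsilon>) \<and> dist (D n 0) (c' s) < \<epsilon> / 2"
      using \<open>0 < \<epsilon>\<close> by (intro eventually_conj almost tendstoD[OF D_init]) auto
    then obtain N where N: "\<And>n t. N \<le> n \<Longrightarrow> t \<in> {0..T} \<Longrightarrow> norm (D' n t - stretching t s (D n t)) \<le> \<epsilon>"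
      "\<And>n. N \<le> n \<Longrightarrow> dist (D n 0) (c' s) < \<epsilon> / 2"
      unfolding eventually_sequentially by blast
    have "dist (D m t) (D n t) < e" if "t \<in> {0..T}" "N \<le> m" "N \<le> n" for m n t
    proof -
      have "norm (D m t - D n t) \<le> C * (norm (D m 0 - D n 0) + 2 * \<epsilon>)"
      proof (rule gronwall_norm[OF has_vector_derivative_diff[OF D_deriv D_deriv]])
        fix \<tau> assume \<tau>: "\<tau> \<in> {0..T}"
        have "D' m \<tau> - D' n \<tau> = stretching \<tau> s (D m \<tau> - D n \<tau>)
            + ((D' m \<tau> - stretching \<tau> s (D m \<tau>)) - (D' n \<tau> - stretching \<tau> s (D n \<tau>)))"
          by (simp add: blinfun.diff_right)
        also have "norm \<dots> \<le> K * norm (D m \<tau> - D n \<tau>) + (\<epsilon> + \<epsilon>)"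
          using \<tau> that by (intro norm_triangle_mono norm_triangle_le_diff stretching_bound add_mono N)
        finally show "norm (D' m \<tau> - D' n \<tau>) \<le> K * norm (D m \<tau> - D n \<tau>) + 2 * \<epsilon>" by simp
      qed (use that K_nonneg \<open>0 < \<epsilon>\<close> in auto)
      also have "\<dots> < C * (\<epsilon> + 2 * \<epsilon>)"
        using N(2)[OF that(2)] N(2)[OF that(3)] C_pos dist_triangle_half_l[of "D m 0" "c' s" \<epsilon> "D n 0"]
        by (intro mult_strict_left_mono) (auto simp: dist_norm)
      also have "\<dots> < e" using \<open>0 < e\<close> C_pos by (simp add: \<epsilon>_def field_simps)
      finally show ?thesis by (simp add: dist_norm)
    qed
    then show "\<exists>M. \<forall>x\<in>{0..T}. \<forall>m\<ge>M. \<forall>n\<ge>M. dist (D m x) (D n x) < e" by blast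
  qed
  then obtain w where w: "uniform_limit {0..T} D w sequentially"
    using Cauchy_uniformly_convergent uniformly_convergent_on_def by blast
  have "\<exists>g. \<forall>t\<in>{0..T}. (\<lambda>n. D n t) \<longlonglongrightarrow> g t \<and>
      (g has_derivative (\<lambda>h. h *\<^sub>R stretching t s (w t))) (at t within {0..T})"
  proof (rule has_derivative_sequence[where f' = "\<lambda>n t h. h *\<^sub>R D' n t" and ?x0.0 = 0 and l = "c' s"])
    show "(D n has_derivative (\<lambda>h. h *\<^sub>R D' n t)) (at t within {0..T})" if "t \<in> {0..T}" for n t
      using D_deriv[OF that] by (simp add: has_vector_derivative_def)
    fix e :: real assume "0 < e"
    then have "\<forall>\<^sub>F n in sequentially. \<forall>t\<in>{0..T}. norm (D' n t - stretching t s (D n t)) \<le> e / 2"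
      by (intro almost) auto
    moreover have "\<forall>\<^sub>F n in sequentially. \<forall>t\<in>{0..T}. dist (D n t) (w t) < e / (2 * (K + 1))"
      using \<open>0 < e\<close> K_nonneg by (intro uniform_limitD[OF w]) auto
    ultimately show "\<forall>\<^sub>F n in sequentially. \<forall>t\<in>{0..T}. \<forall>h.
        norm (h *\<^sub>R D' n t - h *\<^sub>R stretching t s (w t)) \<le> e * norm h"
    proof eventually_elim
      case (elim n)
      show ?case
      proof (intro ballI allI)
        fix t h assume t: "t \<in> {0..T}"
        have "D' n t - stretching t s (w t) = (D' n t - stretching t s (D n t)) + stretching t s (D n t - w t)"
          by (simp add: blinfun.diff_right)
        also have "norm \<dots> \<le> e / 2 + K * (e / (2 * (K + 1)))"
        proof (rule norm_triangle_mono)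
          show "norm (D' n t - stretching t s (D n t)) \<le> e / 2" using elim t by blast
          have "norm (stretching t s (D n t - w t)) \<le> K * norm (D n t - w t)" using t by (rule stretching_bound)
          also have "\<dots> \<le> K * (e / (2 * (K + 1)))"
            using elim(2) t K_nonneg by (intro mult_left_mono) (auto simp: dist_norm intro: less_imp_le)
          finally show "norm (stretching t s (D n t - w t)) \<le> K * (e / (2 * (K + 1)))" .
        qed
        also have "\<dots> \<le> e" using \<open>0 < e\<close> K_nonneg by (simp add: field_simps)
        finally have "\<bar>h\<bar> * norm (D' n t - stretching t s (w t)) \<le> \<bar>h\<bar> * e"
          by (intro mult_left_mono) auto
        then show "norm (h *\<^sub>R D' n t - h *\<^sub>R stretching t s (w t)) \<le> e * norm h"
          by (simp add: mult.commute flip: scaleR_diff_right)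
      qed
    qed
  qed (use T D_init in auto)
  then obtain g where g: "\<And>t. t \<in> {0..T} \<Longrightarrow> (\<lambda>n. D n t) \<longlonglongrightarrow> g t"
    "\<And>t. t \<in> {0..T} \<Longrightarrow> (g has_vector_derivative stretching t s (w t)) (at t within {0..T})"
    unfolding has_vector_derivative_def by blast
  have "w t = g t" if "t \<in> {0..T}" for t
    by (rule LIMSEQ_unique[OF tendsto_uniform_limitI[OF w that] g(1)[OF that]])
  then have "(g has_vector_derivative stretching t s (g t)) (at t within {0..T})" if "t \<in> {0..T}" for t
    using g(2)[OF that] that by simp
  moreover have "g 0 = c' s"
    using LIMSEQ_unique[OF g(1)[of 0] D_init] T by simp
  ultimately show ?thesis by blast
qed

text \<open>A solution with this initial value is unique on \<open>[0,T]\<close> only, hence the choice operator; it is used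
  only at times in \<open>[0,T]\<close>.\<close>

definition tangent :: "real \<Rightarrow> real \<Rightarrow> 'a" where
  "tangent t s = (SOME w. w 0 = c' s \<and>
    (\<forall>t\<in>{0..T}. (w has_vector_derivative stretching t s (w t)) (at t within {0..T}))) t"

lemma
  assumes "s \<in> {0..1}"
  shows tangent_initial: "tangent 0 s = c' s"
    and tangent_ode: "t \<in> {0..T} \<Longrightarrow>
      ((\<lambda>\<tau>. tangent \<tau> s) has_vector_derivative stretching t s (tangent t s)) (at t within {0..T})"
  using someI_ex[OF tangent_exists[OF assms]] unfolding tangent_def by auto

text \<open>A difference quotient for any small increment, not just one from the sequence above, solves the
  variational equation approximately, so it stays close to the exact solution.\<close>

lemma tangent_is_derivative:
  assumes t: "t \<in> {0..T}" and s: "s \<in> {0..1}"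
  shows "(y t has_vector_derivative tangent t s) (at s within {0..1})"
  unfolding has_vector_derivative_iff_quotient
proof (rule tendstoI)
  fix e :: real assume "0 < e"
  define \<epsilon> where "\<epsilon> = e / (2 * C)"
  have "0 < \<epsilon>" using \<open>0 < e\<close> C_pos by (simp add: \<epsilon>_def)
  have "\<forall>\<^sub>F r in at s within {0..1}. dist (quotient s r 0) (c' s) < \<epsilon>"
    using \<open>0 < \<epsilon>\<close> by (intro tendstoD quotient_initial s)
  then show "\<forall>\<^sub>F r in at s within {0..1}. dist ((y t r - y t s) /\<^sub>R (r - s)) (tangent t s) < e"
    using quotient_almost_solves[OF s \<open>0 < \<epsilon>\<close>]
  proof eventually_elim
    case (elim r)
    then have r: "r \<in> {0..1}" by simp
    have "norm (quotient s r t - tangent t s) \<le> C * (norm (quotient s r 0 - tangent 0 s) + \<epsilon>)"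
    proof (rule gronwall_norm[OF has_vector_derivative_diff[OF quotient_deriv[OF _ s r] tangent_ode[OF s]]])
      fix \<tau> assume \<tau>: "\<tau> \<in> {0..T}"
      have "quotient' s r \<tau> - stretching \<tau> s (tangent \<tau> s) =
          stretching \<tau> s (quotient s r \<tau> - tangent \<tau> s) + (quotient' s r \<tau> - stretching \<tau> s (quotient s r \<tau>))"
        by (simp add: blinfun.diff_right)
      also have "norm \<dots> \<le> K * norm (quotient s r \<tau> - tangent \<tau> s) + \<epsilon>"
        using elim \<tau> by (intro norm_triangle_mono stretching_bound) auto
      finally show "norm (quotient' s r \<tau> - stretching \<tau> s (tangent \<tau> s))
          \<le> K * norm (quotient s r \<tau> - tangent \<tau> s) + \<epsilon>" .
    qed (use t K_nonneg \<open>0 < \<epsilon>\<close> in auto)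
    also have "\<dots> < C * (\<epsilon> + \<epsilon>)"
      using elim(1) C_pos by (intro mult_strict_left_mono) (auto simp: dist_norm tangent_initial[OF s])
    also have "\<dots> = e" using C_pos by (simp add: \<epsilon>_def)
    finally show ?case by (simp add: quotient_def dist_norm)
  qed
qed

text \<open>Both the initial value \<open>c' s\<close> and the coefficient of the variational equation depend continuously
  on \<open>s\<close>, the latter uniformly in time; a bounded solution turns the change in the coefficient into a
  small defect.\<close>

lemma tangent_cont: "continuous_on ({0..T} \<times> {0..1}) (\<lambda>(t, s). tangent t s)"
proof (rule continuous_on_Times_if_uniform_limit)
  fix s :: real assume s: "s \<in> {0..1}"
  show "continuous_on {0..T} (\<lambda>t. tangent t s)"
    using has_vector_derivative_continuous[OF tangent_ode[OF s]]
    by (auto simp: continuous_on_eq_continuous_within)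
  define M where "M = C * norm (c' s) + 1"
  have "norm (tangent t s) \<le> C * norm (c' s)" if "t \<in> {0..T}" for t
    using gronwall_norm[OF tangent_ode[OF s], of K 0 t] that stretching_bound K_nonneg
    by (simp add: tangent_initial[OF s])
  then have M: "norm (tangent t s) \<le> M" if "t \<in> {0..T}" for t
    using that by (force simp: M_def)
  have "0 < M" using C_pos by (simp add: M_def add_nonneg_pos)
  show "uniform_limit {0..T} (\<lambda>r t. tangent t r) (\<lambda>t. tangent t s) (at s within {0..1})"
  proof (rule uniform_limitI)
    fix e :: real assume "0 < e"
    define \<epsilon> where "\<epsilon> = e / (2 * C)"
    have "0 < \<epsilon>" using \<open>0 < e\<close> C_pos by (simp add: \<epsilon>_def)
    have "\<forall>\<^sub>F r in at s within {0..1}. dist (c' r) (c' s) < \<epsilon>"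
      using c'_cont s \<open>0 < \<epsilon>\<close> by (intro tendstoD) (auto simp: continuous_on_def)
    moreover have "\<forall>\<^sub>F r in at s within {0..1}. \<forall>t\<in>{0..T}. dist (stretching t r) (stretching t s) < \<epsilon> / M"
      using \<open>0 < \<epsilon>\<close> \<open>0 < M\<close> s
      by (intro uniform_limitD[OF uniform_limit_if_continuous_on_Times[OF _ _ stretching_cont]]) auto
    moreover have "\<forall>\<^sub>F r in at s within {0..1}. r \<in> {0..1}"
      by (simp add: eventually_at_filter)
    ultimately show "\<forall>\<^sub>F r in at s within {0..1}. \<forall>t\<in>{0..T}. dist (tangent t r) (tangent t s) < e"
    proof eventually_elim
      case (elim r)
      then have r: "r \<in> {0..1}" by simp
      show ?case
      proof
        fix t assume t: "t \<in> {0..T}"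
        have "norm (tangent t r - tangent t s) \<le> C * (norm (tangent 0 r - tangent 0 s) + \<epsilon>)"
        proof (rule gronwall_norm[OF has_vector_derivative_diff[OF tangent_ode[OF r] tangent_ode[OF s]]])
          fix \<tau> assume \<tau>: "\<tau> \<in> {0..T}"
          have split: "stretching \<tau> r (tangent \<tau> r) - stretching \<tau> s (tangent \<tau> s) =
              stretching \<tau> r (tangent \<tau> r - tangent \<tau> s) + (stretching \<tau> r - stretching \<tau> s) (tangent \<tau> s)"
            by (simp add: blinfun.diff_right blinfun.diff_left)
          have "norm (stretching \<tau> r (tangent \<tau> r - tangent \<tau> s) + (stretching \<tau> r - stretching \<tau> s) (tangent \<tau> s))
              \<le> K * norm (tangent \<tau> r - tangent \<tau> s) + \<epsilon> / M * M"
          proof (rule norm_triangle_mono[OF stretching_bound[OF \<tau>]])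
            have "norm (stretching \<tau> r - stretching \<tau> s) * norm (tangent \<tau> s) \<le> \<epsilon> / M * M"
              using elim(2) \<tau> M[OF \<tau>] \<open>0 < \<epsilon>\<close> \<open>0 < M\<close>
              by (intro mult_mono) (auto simp: dist_norm intro: less_imp_le)
            then show "norm ((stretching \<tau> r - stretching \<tau> s) (tangent \<tau> s)) \<le> \<epsilon> / M * M"
              using norm_blinfun order_trans by blast
          qed
          moreover have "\<epsilon> / M * M = \<epsilon>" using \<open>0 < M\<close> by simp
          ultimately show "norm (stretching \<tau> r (tangent \<tau> r) - stretching \<tau> s (tangent \<tau> s))
              \<le> K * norm (tangent \<tau> r - tangent \<tau> s) + \<epsilon>"
            unfolding split by metis
        qed (use t K_nonneg \<open>0 < \<epsilon>\<close> in auto)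
        also have "\<dots> < C * (\<epsilon> + \<epsilon>)"
          using elim(1) C_pos
          by (intro mult_strict_left_mono) (auto simp: dist_norm tangent_initial[OF r] tangent_initial[OF s])
        also have "\<dots> = e" using C_pos by (simp add: \<epsilon>_def)
        finally show "dist (tangent t r) (tangent t s) < e" by (simp add: dist_norm)
      qed
    qed
  qed
qed

text \<open>The joint differentiability needed for the chain rule comes from the partial derivative in time
  and the continuous partial derivative in space.\<close>

lemma material_derivative:
  fixes F :: "real \<Rightarrow> 'a \<Rightarrow> 'b::real_normed_vector"
  assumes Ft: "((\<lambda>\<tau>. F \<tau> (y t s)) has_vector_derivative Ft) (at t within {0..T})"
    and DF: "\<And>t x. t \<in> {0..T} \<Longrightarrow> (F t has_derivative blinfun_apply (DF t x)) (at x)"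
    and DF_cont: "continuous_on ({0..T} \<times> UNIV) (\<lambda>(t, x). DF t x)"
    and t: "t \<in> {0..T}" and s: "s \<in> {0..1}"
  shows "((\<lambda>\<tau>. F \<tau> (y \<tau> s)) has_vector_derivative Ft + DF t (y t s) (v t (y t s)))
    (at t within {0..T})"
proof -
  have "((\<lambda>(\<tau>, x). F \<tau> x) has_derivative (\<lambda>(h, k). h *\<^sub>R Ft + DF t (y t s) k))
      (at (t, y t s) within {0..T} \<times> UNIV)"
  proof (rule has_derivative_partialsI)
    show "((\<lambda>\<tau>. F \<tau> (y t s)) has_derivative (\<lambda>h. h *\<^sub>R Ft)) (at t within {0..T})"
      using Ft by (simp add: has_vector_derivative_def)
    show "continuous (at (t, y t s) within {0..T} \<times> UNIV) (\<lambda>(t, x). DF t x)"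
      using DF_cont t by (simp add: continuous_on_eq_continuous_within)
  qed (auto intro: DF)
  then have F: "((\<lambda>(\<tau>, x). F \<tau> x) has_derivative (\<lambda>(h, k). h *\<^sub>R Ft + DF t (y t s) k))
      (at (t, y t s) within (\<lambda>\<tau>. (\<tau>, y \<tau> s)) ` {0..T})"
    by (rule has_derivative_subset) auto
  have "((\<lambda>\<tau>. (\<tau>, y \<tau> s)) has_derivative (\<lambda>h. (h, h *\<^sub>R v t (y t s)))) (at t within {0..T})"
    using trajectory[OF t s] unfolding has_vector_derivative_def by (intro derivative_intros)
  from has_derivative_in_compose[OF this F] show ?thesis
    by (simp add: has_vector_derivative_def blinfun.scaleR_right scaleR_add_right)
qed

text \<open>Differentiation under the integral sign: \<open>F\<close> changes by its material derivative along the
  trajectories, the line element \<open>tangent t s\<close> by the variational equation.\<close>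

lemma transported_line_integral:
  fixes F Ft :: "real \<Rightarrow> 'a \<Rightarrow> 'a" and DF :: "real \<Rightarrow> 'a \<Rightarrow> 'a \<Rightarrow>\<^sub>L 'a"
  assumes Ft: "\<And>t x. t \<in> {0..T} \<Longrightarrow> ((\<lambda>\<tau>. F \<tau> x) has_vector_derivative Ft t x) (at t within {0..T})"
    and DF: "\<And>t x. t \<in> {0..T} \<Longrightarrow> (F t has_derivative blinfun_apply (DF t x)) (at x)"
    and F_cont: "continuous_on ({0..T} \<times> UNIV) (\<lambda>(t, x). F t x)"
    and Ft_cont: "continuous_on ({0..T} \<times> UNIV) (\<lambda>(t, x). Ft t x)"
    and DF_cont: "continuous_on ({0..T} \<times> UNIV) (\<lambda>(t, x). DF t x)"
    and t: "t \<in> {0..T}"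
  defines "I \<equiv> \<lambda>t s. (Ft t (y t s) + DF t (y t s) (v t (y t s))) \<bullet> tangent t s
      + F t (y t s) \<bullet> A t (y t s) (tangent t s)"
  shows "((\<lambda>\<tau>. integral {0..1} (\<lambda>s. F \<tau> (y \<tau> s) \<bullet> tangent \<tau> s)) has_real_derivative
      integral {0..1} (I t)) (at t within {0..T})"
    and "I t integrable_on {0..1}"
proof -
  have "continuous_on ({0..T} \<times> {0..1}) (\<lambda>z. F (fst z) (y (fst z) (snd z)))"
    "continuous_on ({0..T} \<times> {0..1}) (\<lambda>z. Ft (fst z) (y (fst z) (snd z)))"
    "continuous_on ({0..T} \<times> {0..1}) (\<lambda>z. DF (fst z) (y (fst z) (snd z)))"
    "continuous_on ({0..T} \<times> {0..1}) (\<lambda>z. v (fst z) (y (fst z) (snd z)))"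
    "continuous_on ({0..T} \<times> {0..1}) (\<lambda>z. A (fst z) (y (fst z) (snd z)))"
    "continuous_on ({0..T} \<times> {0..1}) (\<lambda>z. tangent (fst z) (snd z))"
    using continuous_on_along[OF F_cont] continuous_on_along[OF Ft_cont] continuous_on_along[OF DF_cont]
      continuous_on_along[OF v_cont] continuous_on_along[OF A_cont] tangent_cont
    by (simp_all add: split_beta)
  note cont = this
  have slice: "continuous_on {0..1} (\<lambda>s. f (\<tau>, s))"
    if "continuous_on ({0..T} \<times> {0..1}) f" "\<tau> \<in> {0..T}" for f :: "real \<times> real \<Rightarrow> real" and \<tau>
    using that by (intro continuous_on_compose2[OF that(1)] continuous_intros) auto
  have I_cont: "continuous_on ({0..T} \<times> {0..1}) (\<lambda>(t, s). I t s)"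
    unfolding I_def split_beta by (intro continuous_intros cont)
  then show "I t integrable_on {0..1}"
    using slice[OF I_cont t] by (simp add: integrable_continuous_interval)
  have "((\<lambda>\<tau>. integral (cbox 0 1) (\<lambda>s. F \<tau> (y \<tau> s) \<bullet> tangent \<tau> s)) has_real_derivative
    integral (cbox 0 1) (I t)) (at t within {0..T})"
  proof (rule leibniz_rule_field_derivative)
    fix \<tau> s :: real assume \<tau>: "\<tau> \<in> {0..T}" and "s \<in> cbox 0 1"
    then have s: "s \<in> {0..1}" by simp
    have "((\<lambda>\<tau>. F \<tau> (y \<tau> s) \<bullet> tangent \<tau> s) has_vector_derivative
        F \<tau> (y \<tau> s) \<bullet> stretching \<tau> s (tangent \<tau> s)
        + (Ft \<tau> (y \<tau> s) + DF \<tau> (y \<tau> s) (v \<tau> (y \<tau> s))) \<bullet> tangent \<tau> s) (at \<tau> within {0..T})"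
      by (rule bounded_bilinear.has_vector_derivative[OF bounded_bilinear_inner
          material_derivative[OF Ft[OF \<tau>] DF DF_cont \<tau> s] tangent_ode[OF s \<tau>]])
    then show "((\<lambda>\<tau>. F \<tau> (y \<tau> s) \<bullet> tangent \<tau> s) has_real_derivative I \<tau> s) (at \<tau> within {0..T})"
      by (simp add: has_real_derivative_iff_has_vector_derivative stretching_def I_def add.commute)
  next
    fix \<tau> assume "\<tau> \<in> {0..T}"
    moreover have "continuous_on ({0..T} \<times> {0..1}) (\<lambda>z. F (fst z) (y (fst z) (snd z)) \<bullet> tangent (fst z) (snd z))"
      by (intro continuous_intros cont)
    ultimately have "continuous_on {0..1} (\<lambda>s. F \<tau> (y \<tau> s) \<bullet> tangent \<tau> s)"
      using slice by fastforce
    then show "(\<lambda>s. F \<tau> (y \<tau> s) \<bullet> tangent \<tau> s) integrable_on cbox 0 1"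
      by (simp add: integrable_continuous_interval)
  qed (use t I_cont in auto)
  then show "((\<lambda>\<tau>. integral {0..1} (\<lambda>s. F \<tau> (y \<tau> s) \<bullet> tangent \<tau> s)) has_real_derivative
      integral {0..1} (I t)) (at t within {0..T})"
    by simp
qed

text \<open>Translating a trajectory by a period of the field gives another trajectory, and trajectories are
  determined by their initial points. So a loop that closes up to a period keeps doing so.\<close>

lemma endpoints_keep_period:
  assumes period: "\<And>t x. t \<in> {0..T} \<Longrightarrow> v t (x + d) = v t x" and d: "y 0 1 = y 0 0 + d"
    and t: "t \<in> {0..T}"
  shows "y t 1 = y t 0 + d"
proof -
  let ?e = "\<lambda>\<tau>. y \<tau> 1 - y \<tau> 0 - d"
  have "norm (?e t) \<le> C * (norm (?e 0) + 0)"
  proof (rule gronwall_norm[where e = ?e and e' = "\<lambda>\<tau>. v \<tau> (y \<tau> 1) - v \<tau> (y \<tau> 0)"])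
    fix \<tau> assume \<tau>: "\<tau> \<in> {0..T}"
    then show "(?e has_vector_derivative v \<tau> (y \<tau> 1) - v \<tau> (y \<tau> 0)) (at \<tau> within {0..T})"
      by (auto intro!: derivative_eq_intros trajectory)
    show "norm (v \<tau> (y \<tau> 1) - v \<tau> (y \<tau> 0)) \<le> K * norm (?e \<tau>) + 0"
      using lipschitz[OF \<tau>, of "y \<tau> 1" "y \<tau> 0 + d"] period[OF \<tau>] by (simp add: diff_diff_eq)
  qed (use t K_nonneg in auto)
  then show ?thesis by (simp add: d diff_eq_eq add.commute)
qed

end

section \<open>Calculus in coordinates of the plane\<close>

lemma partial_d_eq:
  assumes "(f has_derivative f') (at x)"
  shows "partial_d i f x = f' (axis i 1)"
proof -
  have "((\<lambda>h. x + h *\<^sub>R axis i 1) has_derivative (\<lambda>h. h *\<^sub>R axis i 1)) (at (0::real))"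
    by (auto intro!: derivative_eq_intros)
  then have "((\<lambda>h. f (x + h *\<^sub>R axis i 1)) has_derivative (\<lambda>h. f' (h *\<^sub>R axis i 1))) (at (0::real))"
    by (rule has_derivative_compose) (simp add: assms)
  moreover have "f' (h *\<^sub>R axis i 1) = h *\<^sub>R f' (axis i 1)" for h
    using assms by (simp add: has_derivative_linear linear_cmul)
  ultimately show ?thesis
    unfolding partial_d_def by (simp add: has_vector_derivative_def vector_derivative_at)
qed

lemma has_derivative_partials:
  assumes "f differentiable (at x)"
  shows "(f has_derivative (\<lambda>h. \<Sum>i\<in>UNIV. h $ i *\<^sub>R partial_d i f x)) (at x)"
proof -
  obtain f' where f': "(f has_derivative f') (at x)"
    using assms by (auto simp: differentiable_def)
  have "f' h = (\<Sum>i\<in>UNIV. h $ i *\<^sub>R partial_d i f x)" for h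
  proof -
    have "h = (\<Sum>i\<in>UNIV. h $ i *\<^sub>R axis i 1)"
      by (simp add: basis_expansion flip: scalar_mult_eq_scaleR)
    then have "f' h = f' (\<Sum>i\<in>UNIV. h $ i *\<^sub>R axis i 1)" by simp
    also have "\<dots> = (\<Sum>i\<in>UNIV. h $ i *\<^sub>R f' (axis i 1))"
      using has_derivative_linear[OF f'] by (simp add: linear_sum linear_cmul)
    finally show ?thesis by (simp add: partial_d_eq[OF f'])
  qed
  then show ?thesis using f' by (simp add: has_derivative_eq_rhs[OF f'] fun_eq_iff)
qed

lemma has_derivative_grad:
  "f differentiable (at x) \<Longrightarrow> (f has_derivative (\<lambda>h. grad f x \<bullet> h)) (at x)"
  using has_derivative_partials[of f x] by (simp add: grad_def inner_vec_def mult.commute)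

text \<open>The total derivative, built from the coordinate derivatives so that continuity and bounds of
  the latter carry over; as a bounded linear map it is a value whose continuity in time and space can
  be stated.\<close>

definition jacobian :: "(real^2 \<Rightarrow> 'b::real_normed_vector) \<Rightarrow> real^2 \<Rightarrow> (real^2) \<Rightarrow>\<^sub>L 'b" where
  "jacobian f x = Blinfun (\<lambda>h. \<Sum>i\<in>UNIV. h $ i *\<^sub>R partial_d i f x)"

lemma jacobian_apply: "jacobian f x h = (\<Sum>i\<in>UNIV. h $ i *\<^sub>R partial_d i f x)"
proof -
  have "bounded_linear (\<lambda>h::real^2. \<Sum>i\<in>UNIV. h $ i *\<^sub>R partial_d i f x)"
    by (intro bounded_linear_intros bounded_linear_vec_nth)
  then show ?thesis unfolding jacobian_def by (simp add: bounded_linear_Blinfun_apply)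
qed

lemma has_derivative_jacobian:
  "f differentiable (at x) \<Longrightarrow> (f has_derivative jacobian f x) (at x)"
  using has_derivative_partials[of f x] by (simp add: jacobian_apply[abs_def])

lemma continuous_on_jacobian:
  fixes f :: "'z::t2_space \<Rightarrow> real^2 \<Rightarrow> 'b::real_normed_vector"
  assumes "\<And>i. continuous_on S (\<lambda>z. partial_d i (f z) (g z))"
  shows "continuous_on S (\<lambda>z. jacobian (f z) (g z))"
  by (rule continuous_on_blinfun_componentwise)
    (auto simp: jacobian_apply intro!: continuous_intros assms)

lemma norm_jacobian_le: "norm (jacobian f x) \<le> (\<Sum>i\<in>UNIV. norm (partial_d i f x))"
proof (rule norm_blinfun_bound)
  show "norm (jacobian f x h) \<le> (\<Sum>i\<in>UNIV. norm (partial_d i f x)) * norm h" for h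
    unfolding jacobian_apply sum_distrib_right
    by (intro sum_norm_le) (simp add: mult.commute[of _ "norm h"] mult_right_mono component_le_norm_cart)
qed (simp add: sum_nonneg)

lemma advect_eq_jacobian: "advect u f x = jacobian f x (u x)"
  by (simp add: advect_def jacobian_apply)

text \<open>In the plane the Jacobian minus its transpose is the scalar curl times the rotation by a right
  angle. For a curl of \<open>2 \<omega>\<close> this is the Coriolis term of \<open>v\<close>, tested against \<open>w\<close>.\<close>

lemma curl_identity:
  fixes v w :: "real^2"
  shows "jacobian R x v \<bullet> w - jacobian R x w \<bullet> v = curl R x * (v $ 1 * w $ 2 - v $ 2 * w $ 1)"
  by (simp add: jacobian_apply curl_def sum_2 inner_vec_def algebra_simps)

lemma coriolis_inner: "coriolis \<omega> u x \<bullet> w = 2 * \<omega> x * (u x $ 1 * w $ 2 - u x $ 2 * w $ 1)"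
  by (simp add: coriolis_def inner_vec_def sum_2 algebra_simps)

section \<open>Periodic functions on the plane\<close>

definition lattice_vector :: "real \<Rightarrow> real^2 \<Rightarrow> bool" where
  "lattice_vector L d \<longleftrightarrow> (\<forall>i. \<exists>k::int. d $ i = of_int k * L)"

lemma periodic_axis:
  assumes "periodic L f"
  shows "f (x + (of_int k * L) *\<^sub>R axis i 1) = f x"
proof -
  have nat: "f (x + (of_nat n * L) *\<^sub>R axis i 1) = f x" for n :: nat and x
  proof (induction n)
    case (Suc n)
    have "f (x + (of_nat (Suc n) * L) *\<^sub>R axis i 1) = f ((x + (of_nat n * L) *\<^sub>R axis i 1) + L *\<^sub>R axis i 1)"
      by (simp add: algebra_simps)
    also have "\<dots> = f x" using assms Suc by (simp add: periodic_def)
    finally show ?case .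
  qed simp
  show ?thesis
  proof (cases "0 \<le> k")
    case True
    then show ?thesis using nat[of x "nat k"] by simp
  next
    case False
    then show ?thesis
      using nat[of "x + (of_int k * L) *\<^sub>R axis i 1" "nat (- k)"] by (simp add: algebra_simps)
  qed
qed

lemma periodic_lattice_shift:
  assumes f: "periodic L f" and d: "lattice_vector L d"
  shows "f (x + d) = f x"
proof -
  obtain k where k: "\<And>i. d $ i = of_int (k i) * L"
    using d unfolding lattice_vector_def by metis
  have "x + d = (x + (of_int (k 1) * L) *\<^sub>R axis 1 1) + (of_int (k 2) * L) *\<^sub>R axis 2 1"
    by (simp add: vec_eq_iff forall_2 axis_def k)
  then show ?thesis by (simp only: periodic_axis[OF f])
qed

lemma periodic_partial_d:
  assumes "periodic L f"
  shows "periodic L (partial_d i f)"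
  unfolding periodic_def
proof (intro allI)
  fix x j
  have "f (x + L *\<^sub>R axis j 1 + h *\<^sub>R axis i 1) = f (x + h *\<^sub>R axis i 1)" for h
  proof -
    have "f ((x + h *\<^sub>R axis i 1) + L *\<^sub>R axis j 1) = f (x + h *\<^sub>R axis i 1)"
      using assms unfolding periodic_def by blast
    then show ?thesis by (simp add: add.assoc add.commute[of "L *\<^sub>R axis j 1"])
  qed
  then show "partial_d i f (x + L *\<^sub>R axis j 1) = partial_d i f x"
    by (simp add: partial_d_def)
qed

lemma lattice_shift_into_square:
  assumes "0 < L"
  obtains d where "lattice_vector L d" "x + d \<in> square L"
proof
  define d where "d = (\<chi> i. of_int (- \<lfloor>x $ i / L\<rfloor>) * L)"
  show "lattice_vector L d" unfolding lattice_vector_def d_def by (metis vec_lambda_beta)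
  have "of_int \<lfloor>x $ i / L\<rfloor> * L \<le> (x $ i / L) * L"
    "(x $ i / L) * L \<le> (of_int \<lfloor>x $ i / L\<rfloor> + 1) * L" for i
    using assms by (intro mult_right_mono; simp)+
  then have "of_int \<lfloor>x $ i / L\<rfloor> * L \<le> x $ i" "x $ i \<le> (of_int \<lfloor>x $ i / L\<rfloor> + 1) * L" for i
    using assms by simp_all
  then show "x + d \<in> square L"
    by (simp add: square_def mem_box_cart d_def algebra_simps)
qed

lemma periodic_bounded:
  fixes g :: "real \<Rightarrow> real^2 \<Rightarrow> 'b::real_normed_vector"
  assumes "0 < L" and per: "\<And>t. t \<in> {0..T} \<Longrightarrow> periodic L (g t)"
    and cont: "continuous_on ({0..T} \<times> UNIV) (\<lambda>(t, x). g t x)"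
  obtains M where "\<And>t x. t \<in> {0..T} \<Longrightarrow> norm (g t x) \<le> M"
proof -
  have "compact ((\<lambda>(t, x). g t x) ` ({0..T} \<times> square L))"
    unfolding square_def
    by (intro compact_continuous_image compact_Times continuous_on_subset[OF cont]) auto
  then obtain M where "\<forall>z\<in>(\<lambda>(t, x). g t x) ` ({0..T} \<times> square L). norm z \<le> M"
    using compact_imp_bounded bounded_iff by metis
  then have M: "norm (g t x) \<le> M" if "t \<in> {0..T}" "x \<in> square L" for t x
    using that by fastforce
  have "norm (g t x) \<le> M" if "t \<in> {0..T}" for t x
    by (metis lattice_shift_into_square[OF \<open>0 < L\<close>] M periodic_lattice_shift[OF per] that)
  then show ?thesis by (rule that)
qed

text \<open>The translated square sticks out of the original one by a strip of width \<open>h\<close> on one side and leaves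
  a strip of width \<open>h\<close> uncovered on the other; the two strips differ by the period \<open>L\<close>.\<close>

lemma integral_square_shift:
  fixes f :: "real^2 \<Rightarrow> real"
  assumes "continuous_on UNIV f" and per: "periodic L f" and h: "h \<in> {0..L}"
  shows "integral (square L) (\<lambda>x. f (x + h *\<^sub>R axis i 1)) = integral (square L) f"
proof -
  let ?e = "axis i 1 :: real^2" and ?b = "(\<chi> i. L) :: real^2"
  have int: "f integrable_on cbox a b" for a b
    using assms(1) by (intro integrable_continuous continuous_on_subset[OF assms(1)]) auto
  have e: "?e \<in> Basis" by (simp add: axis_in_Basis_iff)
  have coord: "x \<bullet> axis a 1 = x $ a" "axis a (1::real) $ j = (if j = a then 1 else 0)"
    for x :: "real^2" and a j :: 2
    by (simp_all add: inner_axis) (simp add: axis_def)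
  have shift: "integral (cbox a b) (\<lambda>x. f (x + c)) = integral (cbox (a + c) (b + c)) f" for a b c
    using integral_shift_cbox_plus[of a b f c] by (simp add: o_def add.commute)
  have "integral (square L) (\<lambda>x. f (x + h *\<^sub>R ?e)) = integral (cbox (h *\<^sub>R ?e) (?b + h *\<^sub>R ?e)) f"
    by (simp add: square_def shift)
  also have "\<dots> = integral (cbox (h *\<^sub>R ?e) (?b + h *\<^sub>R ?e) \<inter> {x. x \<bullet> ?e \<le> L}) f
      + integral (cbox (h *\<^sub>R ?e) (?b + h *\<^sub>R ?e) \<inter> {x. x \<bullet> ?e \<ge> L}) f"
    by (rule integral_split[OF int e])
  also have "cbox (h *\<^sub>R ?e) (?b + h *\<^sub>R ?e) \<inter> {x. x \<bullet> ?e \<le> L} = cbox (h *\<^sub>R ?e) ?b"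
    using h exhaust_2[of i] by (auto simp: mem_box_cart forall_2 coord)
  \<comment> \<open>The protruding strip, as the translate by the period of the strip left uncovered.\<close>
  also have "cbox (h *\<^sub>R ?e) (?b + h *\<^sub>R ?e) \<inter> {x. x \<bullet> ?e \<ge> L}
      = cbox (0 + L *\<^sub>R ?e) ((\<chi> j. if j = i then h else L) + L *\<^sub>R ?e)"
    using h exhaust_2[of i] by (auto simp: mem_box_cart forall_2 coord)
  also have "integral \<dots> f = integral (cbox 0 (\<chi> j. if j = i then h else L)) f"
    unfolding shift[symmetric] using per by (simp add: periodic_def)
  also have "cbox (h *\<^sub>R ?e) ?b = square L \<inter> {x. x \<bullet> ?e \<ge> h}"
    using h exhaust_2[of i] by (auto simp: square_def mem_box_cart forall_2 coord)
  also have "cbox 0 (\<chi> j. if j = i then h else L) = square L \<inter> {x. x \<bullet> ?e \<le> h}"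
    using h exhaust_2[of i] by (auto simp: square_def mem_box_cart forall_2 coord)
  also have "integral (square L \<inter> {x. x \<bullet> ?e \<ge> h}) f + integral (square L \<inter> {x. x \<bullet> ?e \<le> h}) f
      = integral (square L) f"
    unfolding square_def using integral_split[OF int e, of 0 ?b h] by simp
  finally show ?thesis .
qed

text \<open>The integral of the derivative is the derivative, in the size of the translation, of the integrals
  of the translates, and these are constant. This avoids iterated integrals.\<close>

lemma integral_partial_d_periodic:
  fixes f :: "real^2 \<Rightarrow> real"
  assumes L: "0 < L" and per: "periodic L f" and diff: "f differentiable_on UNIV"
    and cont: "continuous_on UNIV (partial_d i f)"
  shows "integral (square L) (partial_d i f) = 0"
proof -
  let ?e = "axis i 1 :: real^2"
  have f_cont: "continuous_on UNIV f" using diff by (rule differentiable_imp_continuous_on)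
  have "((\<lambda>h. integral (cbox 0 (\<chi> i. L)) (\<lambda>x. f (x + h *\<^sub>R ?e))) has_vector_derivative
      integral (cbox 0 (\<chi> i. L)) (\<lambda>x. partial_d i f (x + 0 *\<^sub>R ?e))) (at 0 within {0..L})"
  proof (rule leibniz_rule_vector_derivative)
    fix h :: real and x
    have "(f has_derivative jacobian f (x + h *\<^sub>R ?e)) (at (x + h *\<^sub>R ?e))"
      using diff by (intro has_derivative_jacobian) (auto simp: differentiable_on_def)
    moreover have "((\<lambda>h. x + h *\<^sub>R ?e) has_derivative (\<lambda>k. k *\<^sub>R ?e)) (at h within {0..L})"
      by (auto intro!: derivative_eq_intros)
    ultimately have "((\<lambda>h. f (x + h *\<^sub>R ?e)) has_derivative (\<lambda>k. jacobian f (x + h *\<^sub>R ?e) (k *\<^sub>R ?e)))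
        (at h within {0..L})"
      by (rule has_derivative_compose[rotated])
    then have "((\<lambda>h. f (x + h *\<^sub>R ?e)) has_vector_derivative jacobian f (x + h *\<^sub>R ?e) ?e) (at h within {0..L})"
      by (simp add: has_vector_derivative_def blinfun.scaleR_right)
    then show "((\<lambda>h. f (x + h *\<^sub>R ?e)) has_vector_derivative partial_d i f (x + h *\<^sub>R ?e)) (at h within {0..L})"
      using partial_d_eq[OF has_derivative_jacobian, of f "x + h *\<^sub>R ?e" i] diff
      by (simp add: differentiable_on_def)
  next
    show "(\<lambda>x. f (x + h *\<^sub>R ?e)) integrable_on cbox 0 (\<chi> i. L)" for h
      by (intro integrable_continuous continuous_on_compose2[OF f_cont] continuous_intros) auto
    show "continuous_on ({0..L} \<times> cbox 0 (\<chi> i. L)) (\<lambda>(h, x). partial_d i f (x + h *\<^sub>R ?e))"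
      unfolding split_beta by (intro continuous_on_compose2[OF cont] continuous_intros) auto
  qed (use L in auto)
  then have "((\<lambda>h. integral (square L) (\<lambda>x. f (x + h *\<^sub>R ?e))) has_vector_derivative
      integral (square L) (partial_d i f)) (at 0 within {0..L})"
    by (simp add: square_def)
  moreover have "((\<lambda>h. integral (square L) (\<lambda>x. f (x + h *\<^sub>R ?e))) has_vector_derivative 0) (at 0 within {0..L})"
    by (rule has_vector_derivative_transform[OF _ _ has_vector_derivative_const])
      (use L integral_square_shift[OF f_cont per] in auto)
  ultimately show ?thesis
    using L by (metis vector_derivative_within_closed_interval atLeastAtMost_iff less_eq_real_def order_refl)
qed

text \<open>A periodic gradient has mean zero, so it passes unchanged into the fluctuation. This is why the
  circulation law may be stated with the full atmospheric velocity although the drag in the momentum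
  equation contains its solenoidal part only: the two differ by a gradient.\<close>

lemma fluctuation_add_grad:
  assumes L: "0 < L" and "continuous_on UNIV u" and q: "periodic L q" "Ck 1 q"
  shows "fluctuation L (\<lambda>x. u x + grad q x) x = fluctuation L u x + grad q x"
proof -
  have cont: "continuous_on UNIV (partial_d i q)" for i
    using q(2) by simp
  then have grad_cont: "continuous_on UNIV (grad q)"
    unfolding grad_def[abs_def] by (intro continuous_intros)
  have int: "f integrable_on square L" if "continuous_on UNIV f" for f :: "real^2 \<Rightarrow> real^2"
    unfolding square_def using that by (intro integrable_continuous continuous_on_subset[OF that]) auto
  have "integral (square L) (grad q) $ i = 0" for i
    using integral_component_eq_cart[OF int[OF grad_cont], of i] integral_partial_d_periodic[OF L q(1) _ cont] q(2)
    by (simp add: grad_def)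
  then have "integral (square L) (grad q) = 0" by (simp add: vec_eq_iff)
  then show ?thesis
    using Henstock_Kurzweil_Integration.integral_add[OF int[OF assms(2)] int[OF grad_cont]]
    by (simp add: fluctuation_def)
qed

section \<open>The circulation theorem\<close>

lemma Ck_Suc_imp_Ck: "Ck (Suc k) f \<Longrightarrow> Ck k f"
  by (induction k arbitrary: f) (auto intro: differentiable_imp_continuous_on)

lemma Ck_Suc_differentiable: "Ck (Suc k) f \<Longrightarrow> f differentiable (at x)"
  by (simp add: differentiable_on_def)

lemma C12_differentiable: "C12 T u \<Longrightarrow> t \<in> {0..T} \<Longrightarrow> u t differentiable (at x)"
  unfolding C12_def numeral_2_eq_2 by (blast intro: Ck_Suc_differentiable)

lemma C12_time_derivative:
  "C12 T u \<Longrightarrow> t \<in> {0..T} \<Longrightarrow> ((\<lambda>\<tau>. u \<tau> x) has_vector_derivative time_d T u t x) (at t within {0..T})"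
  unfolding C12_def time_d_def by (simp add: vector_derivative_works)

lemma C12_continuous:
  assumes "C12 T u"
  shows "continuous_on ({0..T} \<times> UNIV) (\<lambda>(t, x). u t x)"
    and "continuous_on ({0..T} \<times> UNIV) (\<lambda>(t, x). time_d T u t x)"
    and "continuous_on ({0..T} \<times> UNIV) (\<lambda>(t, x). jacobian (u t) x)"
  using assms unfolding C12_def split_beta by (auto intro!: continuous_on_jacobian)

lemma C12_jacobian_bounded:
  assumes "C12 T u" "0 < L" and per: "\<And>t. t \<in> {0..T} \<Longrightarrow> periodic L (u t)"
  obtains K where "\<And>t x. t \<in> {0..T} \<Longrightarrow> norm (jacobian (u t) x) \<le> K"
proof -
  have "\<exists>M. \<forall>t\<in>{0..T}. \<forall>x. norm (partial_d i (u t) x) \<le> M" for i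
  proof -
    have cont: "continuous_on ({0..T} \<times> UNIV) (\<lambda>(t, x). partial_d i (u t) x)"
      using assms(1) by (simp add: C12_def)
    show ?thesis
      by (rule periodic_bounded[OF \<open>0 < L\<close> periodic_partial_d[OF per] cont]) blast+
  qed
  then obtain M where "\<And>i t x. t \<in> {0..T} \<Longrightarrow> norm (partial_d i (u t) x) \<le> M i"
    by metis
  then have "norm (jacobian (u t) x) \<le> (\<Sum>i\<in>UNIV. M i)" if "t \<in> {0..T}" for t x
    using that by (intro order_trans[OF norm_jacobian_le] sum_mono)
  then show ?thesis by (rule that)
qed

text \<open>After differentiating under the integral sign, subtracting the integrand of the claimed right-hand
  side must leave an exact derivative \<open>d/ds \<Phi> (y s)\<close> along the loop. With \<open>x = y s\<close>, \<open>u = uo t x\<close>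
  and \<open>w\<close> the tangent, the terms not cancelled by the momentum equation are, with the factors \<open>1 / Ro\<close>
  on \<open>R\<close> and the pressure left out: \<open>u \<bullet> Du w\<close>, from the stretching of the line element, which contributes \<open>\<bar>u\<bar>\<^sup>2 / 2\<close>;
  \<open>(DR u) \<bullet> w + R \<bullet> Du w\<close> minus the Coriolis term, where the curl identity replaces \<open>(DR u) \<bullet> w\<close> minus the
  Coriolis term by \<open>(DR w) \<bullet> u\<close>, so that \<open>R \<bullet> u\<close> appears; the pressure gradient; and
  \<open>\<sigma> \<nabla>q\<close>, the part by which the two fluctuations differ.\<close>

theorem theorem1p2:
  fixes L T Ro Re \<sigma> :: real
    and \<omega> :: "real^2 \<Rightarrow> real"
    and R :: "real^2 \<Rightarrow> real^2"
    and ua usol uo :: "real \<Rightarrow> real^2 \<Rightarrow> real^2"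
    and q p :: "real \<Rightarrow> real^2 \<Rightarrow> real"
    and \<phi> :: "real \<Rightarrow> real^2 \<Rightarrow> real^2"
    and c :: "real \<Rightarrow> real^2"
  assumes L: "L > 0" and T: "T > 0" and Ro: "Ro > 0" and Re: "Re > 0" and \<sigma>: "\<sigma> < 0"
    and R_smooth: "Ck 1 R"
    and curl_R: "\<And>x. curl R x = 2 * \<omega> x"
    and uo_smooth: "C12 T uo"
    and uo_periodic: "\<And>t. t \<in> {0..T} \<Longrightarrow> periodic L (uo t)"
    and p_smooth: "\<And>t. t \<in> {0..T} \<Longrightarrow> Ck 1 (p t)"
    and p_periodic: "\<And>t. t \<in> {0..T} \<Longrightarrow> periodic L (p t)"
    and ua_decomp: "\<And>t. t \<in> {0..T} \<Longrightarrow> leray_helmholtz L (ua t) (usol t) (q t)"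
    and incompressible: "\<And>t x. t \<in> {0..T} \<Longrightarrow> divergence (uo t) x = 0"
    and momentum: "\<And>t x. t \<in> {0..T} \<Longrightarrow>
      time_d T uo t x + advect (uo t) (uo t) x + (1 / Ro) *\<^sub>R coriolis \<omega> (uo t) x
        + (1 / Ro) *\<^sub>R grad (\<lambda>y. p t y + q t y) x
      = \<sigma> *\<^sub>R (uo t x - fluctuation L (usol t) x) + (1 / Re) *\<^sub>R laplacian (uo t) x"
    and flow: "is_flow T uo \<phi>"
    and loop: "torus_loop L c"
    and R_loop: "periodic L R \<or> c 1 = c 0"
    and t: "t \<in> {0..T}"
  shows "((\<lambda>\<tau>. line_integral (\<lambda>x. uo \<tau> x + (1 / Ro) *\<^sub>R R x) (\<lambda>s. \<phi> \<tau> (c s)))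
    has_real_derivative
      line_integral
        (\<lambda>x. \<sigma> *\<^sub>R (uo t x - fluctuation L (ua t) x) + (1 / Re) *\<^sub>R laplacian (uo t) x)
        (\<lambda>s. \<phi> t (c s)))
    (at t within {0..T})"
proof -
  obtain K where K: "\<And>t x. t \<in> {0..T} \<Longrightarrow> norm (jacobian (uo t) x) \<le> K"
    using C12_jacobian_bounded[OF uo_smooth L uo_periodic] by blast
  obtain c' where c': "\<And>s. s \<in> {0..1} \<Longrightarrow> (c has_vector_derivative c' s) (at s)"
    and c'_cont: "continuous_on {0..1} c'"
    using loop unfolding torus_loop_def C1_differentiable_on_def by blast
  interpret curve_in_flow T K uo "\<lambda>t. jacobian (uo t)" "\<lambda>t s. \<phi> t (c s)" c'
  proof
    show "(uo t has_derivative jacobian (uo t) x) (at x)" if "t \<in> {0..T}" for t x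
      by (rule has_derivative_jacobian[OF C12_differentiable[OF uo_smooth that]])
    show "((\<lambda>s. \<phi> 0 (c s)) has_vector_derivative c' s) (at s within {0..1})" if "s \<in> {0..1}" for s
      using flow c'[OF that] by (simp add: is_flow_def has_vector_derivative_at_within)
  qed (use T K flow C12_continuous[OF uo_smooth] c'_cont in \<open>auto simp: is_flow_def\<close>)

  define y where "y s = \<phi> t (c s)" for s
  define w where "w s = tangent t s" for s
  define u where "u = uo t"
  have y_deriv: "(y has_vector_derivative w s) (at s within {0..1})" if "s \<in> {0..1}" for s
    using tangent_is_derivative[OF t that] by (simp add: y_def[abs_def] w_def)
  have line_integral_eq: "line_integral F (\<lambda>s. \<phi> \<tau> (c s)) = integral {0..1} (\<lambda>s. F (\<phi> \<tau> (c s)) \<bullet> tangent \<tau> s)"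
    if "\<tau> \<in> {0..T}" for F \<tau>
    unfolding line_integral_def
    by (intro integral_cong arg_cong2[where f = inner] refl
        vector_derivative_within_closed_interval tangent_is_derivative that) auto

  have R_diff: "R differentiable (at x)" for x
    using R_smooth by (simp add: differentiable_on_def)
  have R_cont: "continuous_on UNIV R" "continuous_on UNIV (jacobian R)"
    using R_smooth by (auto simp: differentiable_imp_continuous_on intro!: continuous_on_jacobian)
  define DF where "DF \<tau> x = jacobian (uo \<tau>) x + (1 / Ro) *\<^sub>R jacobian R x" for \<tau> x
  \<comment> \<open>The integrand that differentiation under the integral sign produces.\<close>
  define rate where "rate s = (time_d T uo t (y s) + DF t (y s) (u (y s))) \<bullet> w s
      + (u (y s) + (1 / Ro) *\<^sub>R R (y s)) \<bullet> jacobian u (y s) (w s)" for s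
  note C12_cont = C12_continuous[OF uo_smooth, unfolded split_beta]
  have R_cont2: "continuous_on ({0..T} \<times> UNIV) (\<lambda>z. R (snd z))"
    "continuous_on ({0..T} \<times> UNIV) (\<lambda>z. jacobian R (snd z))"
    by (auto intro!: continuous_on_compose2[OF R_cont(1)] continuous_on_compose2[OF R_cont(2)] continuous_intros)
  have transport: "((\<lambda>\<tau>. integral {0..1} (\<lambda>s. (uo \<tau> (\<phi> \<tau> (c s)) + (1 / Ro) *\<^sub>R R (\<phi> \<tau> (c s))) \<bullet> tangent \<tau> s))
      has_real_derivative integral {0..1} rate) (at t within {0..T})"
    and rate_integrable: "rate integrable_on {0..1}"
  proof -
    have 1: "((\<lambda>\<tau>. uo \<tau> x + (1 / Ro) *\<^sub>R R x) has_vector_derivative time_d T uo \<tau> x) (at \<tau> within {0..T})"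
      if "\<tau> \<in> {0..T}" for \<tau> x
      using has_vector_derivative_add[OF C12_time_derivative[OF uo_smooth that] has_vector_derivative_const]
      by simp
    have 2: "((\<lambda>x. uo \<tau> x + (1 / Ro) *\<^sub>R R x) has_derivative DF \<tau> x) (at x)" if "\<tau> \<in> {0..T}" for \<tau> x
      unfolding DF_def plus_blinfun.rep_eq scaleR_blinfun.rep_eq
      by (intro has_derivative_add has_derivative_scaleR_right has_derivative_jacobian R_diff
          C12_differentiable[OF uo_smooth that])
    have 3: "continuous_on ({0..T} \<times> UNIV) (\<lambda>(\<tau>, x). uo \<tau> x + (1 / Ro) *\<^sub>R R x)"
      "continuous_on ({0..T} \<times> UNIV) (\<lambda>(\<tau>, x). DF \<tau> x)"
      unfolding DF_def split_beta by (intro continuous_intros C12_cont R_cont2)+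
    note * = transported_line_integral[OF 1 2 3(1) C12_continuous(2)[OF uo_smooth] 3(2) t]
    show "((\<lambda>\<tau>. integral {0..1} (\<lambda>s. (uo \<tau> (\<phi> \<tau> (c s)) + (1 / Ro) *\<^sub>R R (\<phi> \<tau> (c s))) \<bullet> tangent \<tau> s))
        has_real_derivative integral {0..1} rate) (at t within {0..T})"
      using *(1) unfolding rate_def[abs_def] y_def w_def u_def .
    show "rate integrable_on {0..1}"
      using *(2) unfolding rate_def[abs_def] y_def w_def u_def .
  qed

  define P where "P x = p t x + q t x" for x
  have usol: "periodic L (usol t)" "Ck 1 (usol t)" and q: "periodic L (q t)" "Ck 2 (q t)"
    and ua: "ua t = (\<lambda>x. usol t x + grad (q t) x)"
    using ua_decomp[OF t] by (auto simp: leray_helmholtz_def)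
  have q1: "Ck 1 (q t)" using q(2) Ck_Suc_imp_Ck[of 1 "q t"] unfolding numeral_2_eq_2 One_nat_def by blast
  have q_diff: "q t differentiable (at x)" for x
    using q1 by (simp add: differentiable_on_def)
  have P_diff: "P differentiable (at x)" for x
    using p_smooth[OF t] q_diff unfolding P_def by (auto simp: differentiable_on_def)
  have u_diff: "u differentiable (at x)" for x
    unfolding u_def by (rule C12_differentiable[OF uo_smooth t])
  define target where "target x = \<sigma> *\<^sub>R (u x - fluctuation L (ua t) x) + (1 / Re) *\<^sub>R laplacian u x" for x
  have target_eq: "target x = time_d T uo t x + jacobian u x (u x) + (1 / Ro) *\<^sub>R coriolis \<omega> u x
      + (1 / Ro) *\<^sub>R grad P x - \<sigma> *\<^sub>R grad (q t) x" for x
  proof -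
    have "continuous_on UNIV (usol t)"
      using usol(2) by (auto intro: differentiable_imp_continuous_on)
    then have "fluctuation L (ua t) x = fluctuation L (usol t) x + grad (q t) x"
      unfolding ua by (rule fluctuation_add_grad[OF L _ q(1) q1])
    then have "target x = \<sigma> *\<^sub>R (u x - fluctuation L (usol t) x) + (1 / Re) *\<^sub>R laplacian u x - \<sigma> *\<^sub>R grad (q t) x"
      by (simp add: target_def algebra_simps)
    then show ?thesis
      using momentum[OF t, of x] by (simp add: u_def P_def[abs_def] advect_eq_jacobian)
  qed

  \<comment> \<open>The potential whose increment around the loop is the discrepancy of the two integrals.\<close>
  define \<Phi> where "\<Phi> x = (u x \<bullet> u x) / 2 + (1 / Ro) * (R x \<bullet> u x) - (1 / Ro) * P x + \<sigma> * q t x" for x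
  have \<Phi>_deriv: "((\<lambda>s. \<Phi> (y s)) has_vector_derivative rate s - target (y s) \<bullet> w s) (at s within {0..1})"
    if s: "s \<in> {0..1}" for s
  proof -
    let ?x = "y s" and ?w = "w s"
    have along: "((\<lambda>s. f (y s)) has_vector_derivative f' ?w) (at s within {0..1})"
      if "(f has_derivative f') (at ?x)" for f :: "real^2 \<Rightarrow> 'z::real_normed_vector" and f'
      using has_derivative_compose[OF y_deriv[OF s, unfolded has_vector_derivative_def] that]
        has_derivative_linear[OF that]
      by (simp add: has_vector_derivative_def linear_cmul)
    note du = along[OF has_derivative_jacobian[OF u_diff]]
      and dR = along[OF has_derivative_jacobian[OF R_diff]]
      and dP = along[OF has_derivative_grad[OF P_diff]]
      and dq = along[OF has_derivative_grad[OF q_diff]]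
    have "((\<lambda>s. \<Phi> (y s)) has_vector_derivative
        (u ?x \<bullet> jacobian u ?x ?w + jacobian u ?x ?w \<bullet> u ?x) / 2
        + (1 / Ro) * (R ?x \<bullet> jacobian u ?x ?w + jacobian R ?x ?w \<bullet> u ?x)
        - (1 / Ro) * (grad P ?x \<bullet> ?w) + \<sigma> * (grad (q t) ?x \<bullet> ?w)) (at s within {0..1})"
      unfolding \<Phi>_def
      by (intro has_vector_derivative_add has_vector_derivative_diff has_vector_derivative_mult_right
          has_vector_derivative_divide dP dq
          bounded_bilinear.has_vector_derivative[OF bounded_bilinear_inner] du dR)
    moreover have "rate s - target ?x \<bullet> ?w =
        (u ?x \<bullet> jacobian u ?x ?w + jacobian u ?x ?w \<bullet> u ?x) / 2
        + (1 / Ro) * (R ?x \<bullet> jacobian u ?x ?w + jacobian R ?x ?w \<bullet> u ?x)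
        - (1 / Ro) * (grad P ?x \<bullet> ?w) + \<sigma> * (grad (q t) ?x \<bullet> ?w)"
    proof -
      have "jacobian R ?x (u ?x) \<bullet> ?w = jacobian R ?x ?w \<bullet> u ?x + coriolis \<omega> u ?x \<bullet> ?w"
        using curl_identity[of R ?x "u ?x" ?w] by (simp add: coriolis_inner curl_R)
      then show ?thesis
        unfolding rate_def target_eq DF_def
        by (simp add: blinfun.add_left blinfun.scaleR_left inner_add_left inner_diff_left
            inner_commute[of "jacobian u ?x ?w"] u_def[symmetric] algebra_simps add_divide_distrib)
    qed
    ultimately show ?thesis by simp
  qed

  have \<Phi>_closed: "\<Phi> (y 1) = \<Phi> (y 0)"
  proof -
    have d: "lattice_vector L (c 1 - c 0)"
      using loop by (simp add: torus_loop_def lattice_vector_def)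
    have "y 1 = y 0 + (c 1 - c 0)"
      unfolding y_def
    proof (rule endpoints_keep_period[OF _ _ t])
      show "uo \<tau> (x + (c 1 - c 0)) = uo \<tau> x" if "\<tau> \<in> {0..T}" for \<tau> x
        by (rule periodic_lattice_shift[OF uo_periodic[OF that] d])
      show "\<phi> 0 (c 1) = \<phi> 0 (c 0) + (c 1 - c 0)"
        using flow by (simp add: is_flow_def)
    qed
    \<comment> \<open>A loop that winds around the torus needs a periodic \<open>R\<close>; for a loop closed in the plane the
      period is zero.\<close>
    moreover have "R (y 0 + (c 1 - c 0)) = R (y 0)"
      using R_loop periodic_lattice_shift[OF _ d] by auto
    ultimately show ?thesis
      by (simp add: \<Phi>_def P_def u_def periodic_lattice_shift[OF uo_periodic[OF t] d]
          periodic_lattice_shift[OF p_periodic[OF t] d] periodic_lattice_shift[OF q(1) d])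
  qed

  have "((\<lambda>s. rate s - target (y s) \<bullet> w s) has_integral \<Phi> (y 1) - \<Phi> (y 0)) {0..1}"
    by (rule fundamental_theorem_of_calculus[OF _ \<Phi>_deriv]) auto
  then have "((\<lambda>s. rate s - target (y s) \<bullet> w s) has_integral 0) {0..1}"
    by (simp add: \<Phi>_closed)
  from has_integral_diff[OF integrable_integral[OF rate_integrable] this]
  have "integral {0..1} (\<lambda>s. target (y s) \<bullet> w s) = integral {0..1} rate"
    by (simp add: integral_unique)
  then have rate_eq: "integral {0..1} rate = line_integral target (\<lambda>s. \<phi> t (c s))"
    by (simp add: line_integral_eq[OF t] y_def w_def)
  have "((\<lambda>\<tau>. line_integral (\<lambda>x. uo \<tau> x + (1 / Ro) *\<^sub>R R x) (\<lambda>s. \<phi> \<tau> (c s)))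
      has_real_derivative integral {0..1} rate) (at t within {0..T})"
    by (rule has_field_derivative_transform_within[OF transport, of 1]) (use t in \<open>auto simp: line_integral_eq\<close>)
  then show ?thesis
    unfolding rate_eq target_def[abs_def] u_def .
qed

end
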